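(* Let $G$ be a closed knight's tour on $K_n$. Then the procedure Shatter applied to $G$ returns a tourney, and it runs in time $O(n^2)$.
   Context: For $n\in\mathbb{N}$, the knight's graph $K_n$ is the undirected graph on the $n^2$ cells of an $n\times n$ chessboard, with an edge between two cells iff a chess knight can move between them. For cells $u,v$ joined by a knight move, $\mathrm{km}(u,v)$ denotes the knight move (displacement vector) from $u$ to $v$. A closed knight's tour is a Hamiltonian cycle of $K_n$, represented as a subgraph of $K_n$ by an adjacency list. A tourney on $K_n$ is a vertex-disjoint cycle cover of $K_n$, i.e. a set of (nontrivial) cycles in $K_n$ such that every vertex lies in exactly one cycle. A rail in a subgraph $G$ of $K_n$ is an unordered pair of edges $(e,e')$ of $G$ with $e=(v_0,v_1)$, $e'=(v_2,v_3)$, $\mathrm{km}(v_0,v_1)=\mathrm{km}(v_2,v_3)$, $\mathrm{km}(v_0,v_2)=\mathrm{km}(v_1,v_3)$, and $(v_0,v_2),(v_1,v_3)$ edges of $K_n$ not in $G$. Switching a rail means deleting its two edges $(v_0,v_1),(v_2,v_3)$ and adding the two edges $(v_0,v_2),(v_1,v_3)$. The procedure Shatter, given $G$: constructs a maximal set $D$ of pairwise vertex-disjoint rails of $G$ (no two distinct rails in $D$ share a vertex), switches each rail in $D$, and returns the resulting graph. *)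

theory Defs
  imports "HOL-Library.Landau_Symbols"
begin

section \<open>Knight's graph, tours, tourneys\<close>

type_synonym cell = "int \<times> int"
type_synonym edge = "cell set"
type_synonym graph = "edge set"

definition board :: "nat \<Rightarrow> cell set" where
  "board n = {0..<int n} \<times> {0..<int n}"

definition km :: "cell \<Rightarrow> cell \<Rightarrow> int \<times> int" where
  "km u v = (fst v - fst u, snd v - snd u)"

definition knight_moves :: "(int \<times> int) set" where
  "knight_moves = {(a, b). \<bar>a\<bar> = 1 \<and> \<bar>b\<bar> = 2 \<or> \<bar>a\<bar> = 2 \<and> \<bar>b\<bar> = 1}"

definition knight_graph :: "nat \<Rightarrow> graph" where
  "knight_graph n = {{u, v} | u v. u \<in> board n \<and> v \<in> board n \<and> km u v \<in> knight_moves}"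

definition cycle_edges :: "cell list \<Rightarrow> graph" where
  "cycle_edges vs = {{vs ! i, vs ! (Suc i mod length vs)} | i. i < length vs}"

definition cycle_on :: "nat \<Rightarrow> cell list \<Rightarrow> bool" where
  "cycle_on n vs \<longleftrightarrow> 3 \<le> length vs \<and> distinct vs \<and> cycle_edges vs \<subseteq> knight_graph n"

definition closed_tour :: "nat \<Rightarrow> graph \<Rightarrow> bool" where
  "closed_tour n G \<longleftrightarrow> (\<exists>vs. cycle_on n vs \<and> set vs = board n \<and> G = cycle_edges vs)"

text \<open>A set of cycles is identified with the subgraph formed by their edges, each single cycle
  likewise with its set of edges.\<close>

definition tourney :: "nat \<Rightarrow> graph \<Rightarrow> bool" where
  "tourney n G \<longleftrightarrow>
     (\<exists>\<C>. (\<forall>C\<in>\<C>. \<exists>vs. cycle_on n vs \<and> C = cycle_edges vs)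
        \<and> (\<forall>v\<in>board n. \<exists>!C. C \<in> \<C> \<and> v \<in> \<Union>C)
        \<and> G = \<Union>\<C>)"

section \<open>Rails and the specification of Shatter\<close>

type_synonym rail = "edge set"

definition rails :: "nat \<Rightarrow> graph \<Rightarrow> rail set" where
  "rails n G = {{{v0, v1}, {v2, v3}} | v0 v1 v2 v3.
     {v0, v1} \<in> G \<and> {v2, v3} \<in> G \<and>
     km v0 v1 = km v2 v3 \<and> km v0 v2 = km v1 v3 \<and>
     {v0, v2} \<in> knight_graph n - G \<and> {v1, v3} \<in> knight_graph n - G}"

text \<open>The four end points of the two edges of a rail can be named in several ways, but the
  condition on the displacements makes all of them yield the same two new edges.\<close>

definition new_edges :: "rail \<Rightarrow> edge set" where
  "new_edges R = \<Union>{{{v0, v2}, {v1, v3}} | v0 v1 v2 v3.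
     R = {{v0, v1}, {v2, v3}} \<and> km v0 v1 = km v2 v3}"

definition switch :: "rail \<Rightarrow> graph \<Rightarrow> graph" where
  "switch R G = (G - R) \<union> new_edges R"

definition disjoint_rails :: "nat \<Rightarrow> graph \<Rightarrow> rail set \<Rightarrow> bool" where
  "disjoint_rails n G D \<longleftrightarrow>
     D \<subseteq> rails n G \<and> (\<forall>R\<in>D. \<forall>R'\<in>D. R \<noteq> R' \<longrightarrow> \<Union>R \<inter> \<Union>R' = {})"

definition maximal_disjoint_rails :: "nat \<Rightarrow> graph \<Rightarrow> rail set \<Rightarrow> bool" where
  "maximal_disjoint_rails n G D \<longleftrightarrow>
     disjoint_rails n G D \<and> (\<forall>D'. disjoint_rails n G D' \<and> D \<subseteq> D' \<longrightarrow> D' = D)"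

text \<open>The choice of the maximal set and the order of switching are left open, so Shatter is a
  relation between its input and its possible outputs.\<close>

definition shatter :: "nat \<Rightarrow> graph \<Rightarrow> graph \<Rightarrow> bool" where
  "shatter n G G' \<longleftrightarrow>
     (\<exists>Rs. distinct Rs \<and> maximal_disjoint_rails n G (set Rs) \<and> G' = fold switch Rs G)"

section \<open>Cost model\<close>

text \<open>Programs of a unit-cost random access machine: integer registers and arrays, addition and
  subtraction as the only arithmetic. Every operator, constant, register or array access and
  every test costs one step.\<close>

record store =
  reg :: "string \<Rightarrow> int"
  arr :: "string \<Rightarrow> int \<Rightarrow> int"

datatype aexp = Lit int | Reg string | Arr string aexp | Plus aexp aexp | Minus aexp aexp

datatype bexp = Less aexp aexp | Equal aexp aexp | Not bexp | And bexp bexp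

datatype com =
    Skip
  | Assign string aexp
  | Store string aexp aexp
  | Seq com com
  | If bexp com com
  | While bexp com

primrec aval :: "aexp \<Rightarrow> store \<Rightarrow> int" where
  "aval (Lit k) s = k"
| "aval (Reg x) s = reg s x"
| "aval (Arr a i) s = arr s a (aval i s)"
| "aval (Plus e f) s = aval e s + aval f s"
| "aval (Minus e f) s = aval e s - aval f s"

primrec acost :: "aexp \<Rightarrow> nat" where
  "acost (Lit k) = 1"
| "acost (Reg x) = 1"
| "acost (Arr a i) = 1 + acost i"
| "acost (Plus e f) = 1 + acost e + acost f"
| "acost (Minus e f) = 1 + acost e + acost f"

primrec bval :: "bexp \<Rightarrow> store \<Rightarrow> bool" where
  "bval (Less e f) s \<longleftrightarrow> aval e s < aval f s"
| "bval (Equal e f) s \<longleftrightarrow> aval e s = aval f s"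
| "bval (Not b) s \<longleftrightarrow> \<not> bval b s"
| "bval (And b c) s \<longleftrightarrow> bval b s \<and> bval c s"

primrec bcost :: "bexp \<Rightarrow> nat" where
  "bcost (Less e f) = 1 + acost e + acost f"
| "bcost (Equal e f) = 1 + acost e + acost f"
| "bcost (Not b) = 1 + bcost b"
| "bcost (And b c) = 1 + bcost b + bcost c"

text \<open>\<open>runs c s t s'\<close>: started in \<open>s\<close>, the program \<open>c\<close> halts in \<open>s'\<close> after exactly \<open>t\<close> steps.\<close>

inductive runs :: "com \<Rightarrow> store \<Rightarrow> nat \<Rightarrow> store \<Rightarrow> bool" where
  Skip: "runs Skip s 1 s"
| Assign: "runs (Assign x e) s (1 + acost e) (s\<lparr>reg := (reg s)(x := aval e s)\<rparr>)"
| Store: "runs (Store a i e) s (1 + acost i + acost e)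
            (s\<lparr>arr := (arr s)(a := (arr s a)(aval i s := aval e s))\<rparr>)"
| Seq: "runs c s t s' \<Longrightarrow> runs d s' t' s'' \<Longrightarrow> runs (Seq c d) s (t + t') s''"
| IfTrue: "bval b s \<Longrightarrow> runs c s t s' \<Longrightarrow> runs (If b c d) s (1 + bcost b + t) s'"
| IfFalse: "\<not> bval b s \<Longrightarrow> runs d s t s' \<Longrightarrow> runs (If b c d) s (1 + bcost b + t) s'"
| WhileFalse: "\<not> bval b s \<Longrightarrow> runs (While b c) s (1 + bcost b) s"
| WhileTrue: "bval b s \<Longrightarrow> runs c s t s' \<Longrightarrow> runs (While b c) s' t' s'' \<Longrightarrow>
            runs (While b c) s (1 + bcost b + t + t') s''"

section \<open>Data representation and programs for Shatter\<close>

definition code :: "nat \<Rightarrow> cell \<Rightarrow> int" where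
  "code n v = fst v * int n + snd v"

text \<open>Adjacency lists: a cell has at most 8 neighbours in the knight's graph, so its list gets a
  block of 8 array entries, of which the first \<open>deg\<close> ones are in use, in any order.\<close>

definition adj_list :: "nat \<Rightarrow> store \<Rightarrow> cell \<Rightarrow> int list" where
  "adj_list n s v =
     map (\<lambda>j. arr s ''adj'' (8 * code n v + int j)) [0..<nat (arr s ''deg'' (code n v))]"

definition stores_graph :: "nat \<Rightarrow> graph \<Rightarrow> store \<Rightarrow> bool" where
  "stores_graph n G s \<longleftrightarrow> reg s ''n'' = int n \<and>
     (\<forall>v\<in>board n. distinct (adj_list n s v) \<and> set (adj_list n s v) = code n ` {w. {v, w} \<in> G})"

definition stores_rails :: "nat \<Rightarrow> rail list \<Rightarrow> store \<Rightarrow> bool" where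
  "stores_rails n Rs s \<longleftrightarrow> reg s ''d'' = int (length Rs) \<and>
     (\<forall>i<length Rs. \<exists>v0 v1 v2 v3.
        Rs ! i = {{v0, v1}, {v2, v3}} \<and> km v0 v1 = km v2 v3 \<and>
        arr s ''rails'' (4 * int i) = code n v0 \<and>
        arr s ''rails'' (4 * int i + 1) = code n v1 \<and>
        arr s ''rails'' (4 * int i + 2) = code n v2 \<and>
        arr s ''rails'' (4 * int i + 3) = code n v3)"

definition constructs_rails :: "com \<Rightarrow> bool" where
  "constructs_rails c \<longleftrightarrow>
     (\<forall>n G s. closed_tour n G \<and> stores_graph n G s \<longrightarrow>
        (\<exists>t s' Rs. runs c s t s' \<and> stores_graph n G s' \<and> stores_rails n Rs s' \<and>
           distinct Rs \<and> maximal_disjoint_rails n G (set Rs)))"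

definition switches_rails :: "com \<Rightarrow> bool" where
  "switches_rails c \<longleftrightarrow>
     (\<forall>n G Rs s. closed_tour n G \<and> stores_graph n G s \<and> stores_rails n Rs s \<and>
        distinct Rs \<and> maximal_disjoint_rails n G (set Rs) \<longrightarrow>
        (\<exists>t s'. runs c s t s' \<and> stores_graph n (fold switch Rs G) s'))"

definition shatter_program :: "com \<Rightarrow> bool" where
  "shatter_program p \<longleftrightarrow>
     (\<exists>c d. p = Seq c d \<and> constructs_rails c \<and> switches_rails d)"

end

theory Submission
  imports Defs
begin

text \<open>Switching a rail replaces, at each of its four cells, one neighbour by a new one. So a tour stays
  a spanning two-regular subgraph of the knight's graph, and disjoint rails do not interfere with
  each other. A two-regular graph is the union of its cycles, and these are pairwise disjoint.

  For the running time, the rails are collected greedily: for each cell \<open>v\<^sub>0\<close>, each of the 8 knight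
  moves \<open>v\<^sub>0 \<rightarrow> v\<^sub>2\<close> and each choice of a neighbour \<open>v\<^sub>1\<close> of \<open>v\<^sub>0\<close> and \<open>v\<^sub>3\<close> of \<open>v\<^sub>2\<close>, the rail is taken if it
  is one and no cell of it is marked; its cells are then marked. As every rail is probed, each rail
  has a marked cell in the end, which is maximality. The machine cannot divide, so the coordinates of
  the cells are tabulated first; comparing differences of codes instead would not be sound on small
  boards.\<close>

text \<open>Comparing codes fails because different knight moves can shift the code equally: for n =
  3 both (1, 2) and (2, -1) add 5. Two obstacles shape the rest. A rail is a set of two unordered
  edges, so its end points carry no names; everything about switching rests on showing that all
  admissible namings agree up to symmetry. And a switch is carried out by separate writes, one per
  cell, between which the adjacency lists describe no undirected graph, since v0 may already list v2
  while v2 does not list v0. The stored data are therefore described by a neighbour function rather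
  than by a set of edges. The quadratic bound comes from a constant amount of loop-free work per
  cell: 8 moves times 2 times 2 neighbour choices give 32 probes, written out in sequence instead of
  looped over.\<close>

section \<open>Neighbour sets and degrees in cycles\<close>

definition nbrs :: "graph \<Rightarrow> cell \<Rightarrow> cell set" where
  "nbrs G v = {w. {v, w} \<in> G}"

definition two_regular :: "nat \<Rightarrow> graph \<Rightarrow> bool" where
  "two_regular n G \<longleftrightarrow> G \<subseteq> knight_graph n \<and> (\<forall>v\<in>board n. card (nbrs G v) = 2)"

lemma finite_board: "finite (board n)"
  by (simp add: board_def)

lemma card_board: "card (board n) = n\<^sup>2"
  by (simp add: board_def card_cartesian_product power2_eq_square)

lemma knight_graphD:
  assumes "{u, v} \<in> knight_graph n"
  shows "u \<in> board n" "v \<in> board n" "u \<noteq> v" "km u v \<in> knight_moves"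
  using assms by (auto simp: knight_graph_def km_def knight_moves_def doubleton_eq_iff)

lemma knight_graph_doubleton:
  assumes "e \<in> knight_graph n"
  obtains u v where "e = {u, v}" "u \<in> board n" "v \<in> board n" "u \<noteq> v"
proof -
  obtain u v where "e = {u, v}" "u \<in> board n" "v \<in> board n"
    using assms unfolding knight_graph_def by blast
  moreover from this have "u \<noteq> v"
    using assms knight_graphD(3) by blast
  ultimately show ?thesis
    using that by blast
qed

lemma nbrs_subset_board:
  assumes "G \<subseteq> knight_graph n"
  shows "nbrs G v \<subseteq> board n"
  using assms knight_graphD(2) unfolding nbrs_def by blast

text \<open>A vertex lies on the edge that its index starts and on the one that its index ends. The
  predecessor is written \<open>i + length vs - 1\<close> so that natural subtraction does not
  truncate at index 0.\<close>

lemma nbrs_cycle_edges: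
  assumes "distinct vs" "i < length vs"
  shows "nbrs (cycle_edges vs) (vs ! i) =
    {vs ! (Suc i mod length vs), vs ! ((i + length vs - 1) mod length vs)}"
proof -
  let ?l = "length vs"
  have pred: "Suc k mod ?l = i \<longleftrightarrow> k = (i + ?l - 1) mod ?l" if "k < ?l" for k
  proof (cases "Suc k = ?l")
    case True
    then show ?thesis using that assms(2) by (cases i) (auto simp: mod_if)
  next
    case False
    then show ?thesis using that assms(2) by (cases i) (auto simp: mod_if)
  qed
  have lt: "m mod ?l < ?l" for m
    using assms(2) by (intro mod_less_divisor) auto
  have idx: "vs ! i = vs ! k \<longleftrightarrow> i = k" if "k < ?l" for k
    using assms that by (simp add: nth_eq_iff_index_eq)
  have "w \<in> nbrs (cycle_edges vs) (vs ! i) \<longleftrightarrow>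
      (\<exists>k<?l. i = k \<and> w = vs ! (Suc k mod ?l) \<or> i = Suc k mod ?l \<and> w = vs ! k)" for w
    unfolding nbrs_def cycle_edges_def using idx lt
    by (auto simp: doubleton_eq_iff)
  moreover have "(\<exists>k<?l. i = k \<and> w = vs ! (Suc k mod ?l) \<or> i = Suc k mod ?l \<and> w = vs ! k) \<longleftrightarrow>
      w = vs ! (Suc i mod ?l) \<or> w = vs ! ((i + ?l - 1) mod ?l)" for w
    using pred lt[of "i + ?l - 1"] assms(2) by metis
  ultimately show ?thesis
    by (simp add: set_eq_iff)
qed

text \<open>From three vertices on, the cyclic successor and predecessor of an index differ; on two
  vertices they would coincide.\<close>

lemma card_nbrs_cycle_edges:
  assumes "distinct vs" "3 \<le> length vs" "v \<in> set vs"
  shows "card (nbrs (cycle_edges vs) v) = 2"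
proof -
  obtain i where i: "i < length vs" "v = vs ! i"
    using assms(3) by (auto simp: in_set_conv_nth)
  have "Suc i mod length vs \<noteq> (i + length vs - 1) mod length vs"
    using i assms(2) by (cases i) (auto simp: mod_if)
  moreover have "Suc i mod length vs < length vs" "(i + length vs - 1) mod length vs < length vs"
    using i by (auto intro: mod_less_divisor)
  ultimately have "vs ! (Suc i mod length vs) \<noteq> vs ! ((i + length vs - 1) mod length vs)"
    using assms(1) by (simp add: nth_eq_iff_index_eq)
  then show ?thesis
    using nbrs_cycle_edges[OF assms(1) i(1)] i(2) by simp
qed

lemma closed_tour_two_regular:
  assumes "closed_tour n G"
  shows "two_regular n G"
  using assms card_nbrs_cycle_edges
  by (auto simp: closed_tour_def cycle_on_def two_regular_def)

text \<open>An empty board has no room for a cycle of length at least three. Positivity makes the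
  initial column counter 0 a legal column.\<close>

lemma closed_tour_pos:
  assumes "closed_tour n G"
  shows "0 < n"
proof (rule ccontr)
  assume "\<not> 0 < n"
  then show False using assms by (auto simp: closed_tour_def cycle_on_def board_def)
qed

subsection \<open>Two-regular subgraphs are tourneys\<close>

lemma Union_cycle_edges:
  assumes "vs \<noteq> []"
  shows "\<Union>(cycle_edges vs) = set vs"
proof
  have "Suc i mod length vs < length vs" for i
    using assms by simp
  then show "\<Union>(cycle_edges vs) \<subseteq> set vs"
    by (auto simp: cycle_edges_def)
  show "set vs \<subseteq> \<Union>(cycle_edges vs)"
  proof
    fix v
    assume "v \<in> set vs"
    then obtain i where "i < length vs" "v = vs ! i"
      by (auto simp: in_set_conv_nth)
    then show "v \<in> \<Union>(cycle_edges vs)"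
      unfolding cycle_edges_def by (intro UnionI[of "{vs ! i, vs ! (Suc i mod length vs)}"]) auto
  qed
qed

text \<open>Induction on the number of steps walked around the cycle from v.\<close>

lemma cycle_subset_closed:
  assumes "v \<in> set vs" "v \<in> A" "\<And>u w. {u, w} \<in> cycle_edges vs \<Longrightarrow> u \<in> A \<Longrightarrow> w \<in> A"
  shows "set vs \<subseteq> A"
proof
  obtain i where i: "i < length vs" "v = vs ! i"
    using assms(1) by (auto simp: in_set_conv_nth)
  have step: "vs ! ((i + k) mod length vs) \<in> A" for k
  proof (induction k)
    case 0
    then show ?case using i assms(2) by simp
  next
    case (Suc k)
    let ?m = "(i + k) mod length vs"
    have "?m < length vs" "Suc ?m mod length vs = (i + Suc k) mod length vs"
      using i by (auto simp: mod_Suc_eq intro: mod_less_divisor)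
    then have "{vs ! ?m, vs ! ((i + Suc k) mod length vs)} \<in> cycle_edges vs"
      unfolding cycle_edges_def by auto
    then show ?case using Suc assms(3) by blast
  qed
  fix u
  assume "u \<in> set vs"
  then obtain j where j: "j < length vs" "u = vs ! j"
    by (auto simp: in_set_conv_nth)
  \<comment> \<open>This many steps lead from index i past the end of the list to index j.\<close>
  have "(i + (length vs - i + j)) mod length vs = j"
    using i j by simp
  then show "u \<in> A"
    using step[of "length vs - i + j"] j by simp
qed

text \<open>A cycle already uses both edges at each of its vertices: its neighbour set is a
  two-element subset of a two-element set.\<close>

lemma cycle_nbrs_eq:
  assumes "two_regular n G" "cycle_on n vs" "cycle_edges vs \<subseteq> G" "v \<in> set vs"
  shows "nbrs (cycle_edges vs) v = nbrs G v"
proof (rule card_subset_eq)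
  have "vs \<noteq> []"
    using assms(4) by auto
  then obtain e where "e \<in> cycle_edges vs" "v \<in> e"
    using assms(4) Union_cycle_edges[of vs] by blast
  moreover from this have "e \<in> knight_graph n"
    using assms(2) by (auto simp: cycle_on_def)
  ultimately have v: "v \<in> board n"
    by (blast elim: knight_graph_doubleton)
  show "finite (nbrs G v)"
    using assms(1) v by (intro card_ge_0_finite) (auto simp: two_regular_def)
  show "nbrs (cycle_edges vs) v \<subseteq> nbrs G v"
    using assms(3) by (auto simp: nbrs_def)
  show "card (nbrs (cycle_edges vs) v) = card (nbrs G v)"
    using assms v card_nbrs_cycle_edges by (simp add: two_regular_def cycle_on_def)
qed

text \<open>Both cycles inherit their neighbour sets from G, so the vertices of the second are
  closed under the edges of the first, and these edges belong to the second as well. Used in both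
  directions, this makes the cycle through a vertex unique.\<close>

lemma cycles_sharing_vertex_subset:
  assumes "two_regular n G"
    and vs: "cycle_on n vs" "cycle_edges vs \<subseteq> G" "v \<in> set vs"
    and ws: "cycle_on n ws" "cycle_edges ws \<subseteq> G" "v \<in> set ws"
  shows "cycle_edges vs \<subseteq> cycle_edges ws"
proof
  have cl: "w \<in> set ws \<and> {u, w} \<in> cycle_edges ws" if "{u, w} \<in> cycle_edges vs" "u \<in> set ws" for u w
  proof -
    have "w \<in> nbrs (cycle_edges ws) u"
      using cycle_nbrs_eq[OF assms(1) ws(1,2)] that vs(2) by (auto simp: nbrs_def)
    then have e: "{u, w} \<in> cycle_edges ws"
      by (simp add: nbrs_def)
    moreover have "ws \<noteq> []"
      using ws(3) by auto
    ultimately show ?thesis using Union_cycle_edges[of ws] by blast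
  qed
  then have sub: "set vs \<subseteq> set ws"
    using vs(3) ws(3) by (intro cycle_subset_closed) auto
  fix e
  assume "e \<in> cycle_edges vs"
  then obtain u w where "e = {u, w}" "u \<in> set vs"
    unfolding cycle_edges_def using nth_mem by blast
  then show "e \<in> cycle_edges ws"
    using cl sub \<open>e \<in> cycle_edges vs\<close> by blast
qed

text \<open>The last vertex of a longest path from \<open>v\<close> has a neighbour on the path besides its
  predecessor; only \<open>v\<close> itself can have a free neighbour slot for it.\<close>

lemma two_regular_cycle_through:
  assumes reg: "two_regular n G" and v: "v \<in> board n"
  obtains vs where "cycle_on n vs" "cycle_edges vs \<subseteq> G" "v \<in> set vs"
proof -
  define path where "path p \<longleftrightarrow> p \<noteq> [] \<and> p ! 0 = v \<and> distinct p \<and> set p \<subseteq> board n \<and>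
    (\<forall>i. Suc i < length p \<longrightarrow> {p ! i, p ! Suc i} \<in> G)" for p
  have GK: "G \<subseteq> knight_graph n" and card2: "\<And>u. u \<in> board n \<Longrightarrow> card (nbrs G u) = 2"
    using reg by (auto simp: two_regular_def)
  have "path [v]"
    using v by (simp add: path_def)
  moreover have "length p < Suc (card (board n))" if "path p" for p
    using that card_mono[OF finite_board, of "set p" n] by (simp add: path_def distinct_card)
  ultimately obtain p where p: "path p" and longest: "\<And>q. path q \<Longrightarrow> length q \<le> length p"
    using ex_has_greatest_nat[of path "[v]" length "Suc (card (board n))"] by (metis less_imp_le)
  define l where "l = length p"
  have l0: "0 < l" and p0: "p ! 0 = v" and dist: "distinct p" and pb: "set p \<subseteq> board n"
    and step: "\<And>i. Suc i < l \<Longrightarrow> {p ! i, p ! Suc i} \<in> G"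
    using p by (auto simp: path_def l_def)
  define x where "x = p ! (l - 1)"
  have xb: "x \<in> board n"
    using pb l0 by (auto simp: x_def l_def)
  have on_path: "w \<in> set p" if "w \<in> nbrs G x" for w
  proof (rule ccontr)
    assume w: "w \<notin> set p"
    have "{(p @ [w]) ! i, (p @ [w]) ! Suc i} \<in> G" if "i < l" for i
    proof (cases "Suc i < l")
      case True
      then show ?thesis using step by (simp add: nth_append l_def)
    next
      case False
      then have "i = l - 1" "Suc i = length p"
        using that by (auto simp: l_def)
      then show ?thesis
        using \<open>w \<in> nbrs G x\<close> by (simp add: nth_append x_def nbrs_def)
    qed
    moreover have "w \<in> board n"
      using that nbrs_subset_board[OF GK] by blast
    ultimately have "path (p @ [w])"
      using p w unfolding path_def l_def by (simp add: nth_append)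
    then show False using longest by force
  qed
  \<comment> \<open>A neighbour other than the predecessor on the path. The guard
    \<open>1 < l\<close> covers the one-vertex path, where \<open>l - 2\<close> truncates to 0 and
    would name x itself.\<close>
  have "\<exists>w. w \<in> nbrs G x \<and> \<not> (1 < l \<and> w = p ! (l - 2))"
  proof -
    obtain a b where ab: "nbrs G x = {a, b}" "a \<noteq> b"
      using card2[OF xb] unfolding card_2_iff by blast
    then show ?thesis
      by (intro exI[of _ "if a = p ! (l - 2) then b else a"]) auto
  qed
  then obtain w where w: "w \<in> nbrs G x" "\<not> (1 < l \<and> w = p ! (l - 2))"
    by blast
  obtain j where j: "j < l" "w = p ! j"
    using on_path[OF w(1)] by (auto simp: in_set_conv_nth l_def)
  have "w \<noteq> x"
    using w(1) GK knight_graphD(3) unfolding nbrs_def by blast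
  then have "j \<noteq> l - 1"
    using j by (auto simp: x_def)
  then have j1: "Suc j < l"
    using j l0 by linarith
  moreover from this have "j \<noteq> l - 2"
    using w(2) j by auto
  \<comment> \<open>With the last two indices excluded, the cycle closed by w is not a degenerate
    one on two vertices.\<close>
  ultimately have len: "3 \<le> l" and j3: "Suc j < l - 1"
    by linarith+
  have "j = 0"
  proof (rule ccontr)
    assume "j \<noteq> 0"
    then obtain i where i: "j = Suc i"
      by (cases j) auto
    \<comment> \<open>An inner vertex of the path would have its predecessor, its successor and x as
      three neighbours.\<close>
    have "{p ! i, p ! Suc j, x} \<subseteq> nbrs G w"
      using step[of i] step[of j] w(1) j j1 by (auto simp: i nbrs_def insert_commute)
    moreover have "card {p ! i, p ! Suc j, x} = 3"
      using dist j1 j3 i by (simp add: x_def nth_eq_iff_index_eq l_def)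
    moreover have "card (nbrs G w) = 2"
      using card2 pb on_path[OF w(1)] by blast
    moreover from this have "finite (nbrs G w)"
      by (intro card_ge_0_finite) simp
    ultimately show False
      using card_mono[of "nbrs G w" "{p ! i, p ! Suc j, x}"] by simp
  qed
  then have close: "{x, p ! 0} \<in> G"
    using w(1) j by (simp add: nbrs_def)
  have "{p ! i, p ! (Suc i mod l)} \<in> G" if "i < l" for i
  proof (cases "Suc i < l")
    case True
    then show ?thesis using step by simp
  next
    case False
    then have "Suc i = l"
      using that by simp
    then show ?thesis using close by (auto simp: x_def)
  qed
  then have sub: "cycle_edges p \<subseteq> G"
    by (auto simp: cycle_edges_def l_def)
  then have "cycle_on n p"
    using GK dist len by (auto simp: cycle_on_def l_def)
  moreover have "v \<in> set p"
    using p0 l0 by (auto simp: l_def)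
  ultimately show ?thesis
    using that sub by blast
qed

text \<open>The cover consists of all cycles inside G, taken as edge sets, so that rotations and
  reversals of a vertex list count once.\<close>

lemma two_regular_tourney:
  assumes reg: "two_regular n G"
  shows "tourney n G"
proof -
  define \<C> where "\<C> = {cycle_edges vs | vs. cycle_on n vs \<and> cycle_edges vs \<subseteq> G}"
  have cells: "\<Union>(cycle_edges vs) = set vs" if "cycle_on n vs" for vs
    using that by (intro Union_cycle_edges) (auto simp: cycle_on_def)
  have "\<exists>!C. C \<in> \<C> \<and> v \<in> \<Union>C" if v: "v \<in> board n" for v
  proof (rule ex_ex1I)
    obtain vs where "cycle_on n vs" "cycle_edges vs \<subseteq> G" "v \<in> set vs"
      using two_regular_cycle_through[OF reg v] .
    then have "cycle_edges vs \<in> \<C> \<and> v \<in> \<Union>(cycle_edges vs)"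
      unfolding \<C>_def using cells by (simp only: mem_Collect_eq) blast
    then show "\<exists>C. C \<in> \<C> \<and> v \<in> \<Union>C" ..
    fix C D
    assume C: "C \<in> \<C> \<and> v \<in> \<Union>C" and D: "D \<in> \<C> \<and> v \<in> \<Union>D"
    obtain vs where "C = cycle_edges vs" "cycle_on n vs" "cycle_edges vs \<subseteq> G"
      using C unfolding \<C>_def by blast
    moreover obtain ws where "D = cycle_edges ws" "cycle_on n ws" "cycle_edges ws \<subseteq> G"
      using D unfolding \<C>_def by blast
    moreover have "v \<in> set vs" "v \<in> set ws"
      using C D cells calculation by auto
    ultimately show "C = D"
      using cycles_sharing_vertex_subset[OF reg] by (simp add: subset_antisym)
  qed
  moreover have "G \<subseteq> \<Union>\<C>"
  proof
    fix e
    assume e: "e \<in> G"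
    then obtain u w where uw: "e = {u, w}" "u \<in> board n"
      using reg unfolding two_regular_def by (blast elim: knight_graph_doubleton)
    obtain vs where vs: "cycle_on n vs" "cycle_edges vs \<subseteq> G" "u \<in> set vs"
      using two_regular_cycle_through[OF reg uw(2)] .
    have "e \<in> cycle_edges vs"
      using cycle_nbrs_eq[OF reg vs] e uw by (auto simp: nbrs_def)
    then show "e \<in> \<Union>\<C>"
      using vs by (auto simp: \<C>_def)
  qed
  ultimately show ?thesis
    unfolding tourney_def by (intro exI[of _ \<C>]) (auto simp: \<C>_def)
qed

subsection \<open>Switching rails\<close>

text \<open>Both equations say v0 + v3 = v1 + v2: the four cells form a parallelogram.\<close>

lemma parallel_sides:
  assumes "km v0 v1 = km v2 v3"
  shows "km v0 v2 = km v1 v3"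
  using assms by (auto simp: km_def)

text \<open>The equation on displacements leaves four namings of a rail: the two edges may be
  swapped, and both may be reversed together. All four give the same new edges, so
  \<open>new_edges\<close> is a union over a single set.\<close>

lemma switch_rail:
  assumes GK: "G \<subseteq> knight_graph n" and R: "R \<in> rails n G"
    and eq: "R = {{v0, v1}, {v2, v3}}" and km: "km v0 v1 = km v2 v3"
  shows "{v0, v1} \<in> G" "{v2, v3} \<in> G"
    "{v0, v2} \<in> knight_graph n - G" "{v1, v3} \<in> knight_graph n - G"
    "distinct [v0, v1, v2, v3]"
    "new_edges R = {{v0, v2}, {v1, v3}}"
proof -
  obtain a b c d where R': "R = {{a, b}, {c, d}}" and G: "{a, b} \<in> G" "{c, d} \<in> G"
    and km': "km a b = km c d" and N: "{a, c} \<in> knight_graph n - G" "{b, d} \<in> knight_graph n - G"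
    using R by (auto simp: rails_def)
  have ne: "a \<noteq> b" "c \<noteq> d" "a \<noteq> c" "b \<noteq> d"
    using G N GK knight_graphD(3) by blast+
  \<comment> \<open>A coincidence across a diagonal would make a new edge equal to an edge of
    G.\<close>
  have ne': "a \<noteq> d" "b \<noteq> c"
    using G N by (auto simp: insert_commute)
  have key: "(w0, w1, w2, w3) \<in> {(a, b, c, d), (b, a, d, c), (c, d, a, b), (d, c, b, a)}"
    if "R = {{w0, w1}, {w2, w3}}" "km w0 w1 = km w2 w3" for w0 w1 w2 w3
  proof -
    have "({w0, w1} = {a, b} \<and> {w2, w3} = {c, d}) \<or> ({w0, w1} = {c, d} \<and> {w2, w3} = {a, b})"
      using that(1) R' by (auto simp: doubleton_eq_iff)
    \<comment> \<open>Reversing just one of the edges negates its displacement, which is not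
      zero.\<close>
    moreover have "km a b \<noteq> km d c" "km b a \<noteq> km c d"
      using km' ne by (auto simp: km_def prod_eq_iff)
    ultimately show ?thesis
      using that(2) by (auto simp: doubleton_eq_iff)
  qed
  show "{v0, v1} \<in> G" "{v2, v3} \<in> G"
    "{v0, v2} \<in> knight_graph n - G" "{v1, v3} \<in> knight_graph n - G"
    "distinct [v0, v1, v2, v3]"
    using key[OF eq km] G N ne ne' by (auto simp: insert_commute)
  have same: "{{w0, w2}, {w1, w3}} = {{a, c}, {b, d}}"
    if "R = {{w0, w1}, {w2, w3}}" "km w0 w1 = km w2 w3" for w0 w1 w2 w3
    using key[OF that] by (auto simp: insert_commute)
  have "{{{w0, w2}, {w1, w3}} | w0 w1 w2 w3. R = {{w0, w1}, {w2, w3}} \<and> km w0 w1 = km w2 w3} =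
      {{{a, c}, {b, d}}}" (is "?S = _")
  proof
    show "?S \<subseteq> {{{a, c}, {b, d}}}"
    proof
      fix E
      assume "E \<in> ?S"
      then obtain w0 w1 w2 w3 where "E = {{w0, w2}, {w1, w3}}"
        and w: "R = {{w0, w1}, {w2, w3}}" "km w0 w1 = km w2 w3"
        unfolding mem_Collect_eq by (elim exE conjE)
      then show "E \<in> {{{a, c}, {b, d}}}"
        using same[OF w] by (simp only: singleton_iff)
    qed
    have "{{a, c}, {b, d}} \<in> ?S"
      unfolding mem_Collect_eq
      by (rule exI[of _ a], rule exI[of _ b], rule exI[of _ c], rule exI[of _ d])
        (intro conjI refl R' km')
    then show "{{{a, c}, {b, d}}} \<subseteq> ?S"
      by (simp only: insert_subset empty_subsetI simp_thms)
  qed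
  then have "new_edges R = {{a, c}, {b, d}}"
    unfolding new_edges_def by simp
  then show "new_edges R = {{v0, v2}, {v1, v3}}"
    using key[OF eq km] by (auto simp: insert_commute)
qed

lemma rail_cases:
  assumes "R \<in> rails n G"
  obtains v0 v1 v2 v3 where "R = {{v0, v1}, {v2, v3}}" "km v0 v1 = km v2 v3"
  using assms by (auto simp: rails_def)

text \<open>The form of four function updates matches the four array writes of the program; the
  cells are distinct, so the updates do not interfere.\<close>

lemma nbrs_switch:
  assumes GK: "G \<subseteq> knight_graph n" and R: "R \<in> rails n G"
    and eq: "R = {{v0, v1}, {v2, v3}}" and km: "km v0 v1 = km v2 v3"
  shows "nbrs (switch R G) = (nbrs G)
    (v0 := insert v2 (nbrs G v0 - {v1}), v1 := insert v3 (nbrs G v1 - {v0}),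
     v2 := insert v0 (nbrs G v2 - {v3}), v3 := insert v1 (nbrs G v3 - {v2}))"
  using switch_rail(5,6)[OF assms] unfolding switch_def
  by (auto simp: fun_eq_iff nbrs_def eq doubleton_eq_iff)

lemma card_exchange:
  assumes "card A = 2" "y \<in> A" "z \<notin> A"
  shows "card (insert z (A - {y})) = 2"
  using assms by (auto simp: card_2_iff insert_Diff_if)

lemma two_regular_switch:
  assumes reg: "two_regular n G" and R: "R \<in> rails n G"
  shows "two_regular n (switch R G)"
proof -
  have GK: "G \<subseteq> knight_graph n" and card2: "\<And>u. u \<in> board n \<Longrightarrow> card (nbrs G u) = 2"
    using reg by (auto simp: two_regular_def)
  obtain v0 v1 v2 v3 where eq: "R = {{v0, v1}, {v2, v3}}" and km: "km v0 v1 = km v2 v3"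
    using rail_cases[OF R] .
  note sw = switch_rail[OF GK R eq km]
  have "switch R G \<subseteq> knight_graph n"
    using sw GK by (auto simp: switch_def)
  moreover have "card (nbrs (switch R G) u) = 2" if "u \<in> board n" for u
    using card2[OF that] sw(1-5) unfolding nbrs_switch[OF GK R eq km]
    by (auto simp: insert_commute nbrs_def intro!: card_exchange)
  ultimately show ?thesis
    by (simp add: two_regular_def)
qed

text \<open>Switching R touches only edges between cells of R, whereas the edges and non-edges that
  make R' a rail join cells of R'.\<close>

lemma rails_switch_disjoint:
  assumes GK: "G \<subseteq> knight_graph n" and R: "R \<in> rails n G" and R': "R' \<in> rails n G"
    and disj: "\<Union>R \<inter> \<Union>R' = {}"
  shows "R' \<in> rails n (switch R G)"
proof -
  obtain v0 v1 v2 v3 where eq: "R = {{v0, v1}, {v2, v3}}" and km: "km v0 v1 = km v2 v3"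
    using rail_cases[OF R] .
  obtain w0 w1 w2 w3 where eq': "R' = {{w0, w1}, {w2, w3}}" and km': "km w0 w1 = km w2 w3"
    using rail_cases[OF R'] .
  note sw = switch_rail[OF GK R' eq' km']
  have "{w0, w1} \<in> switch R G" "{w2, w3} \<in> switch R G"
    "{w0, w2} \<in> knight_graph n - switch R G" "{w1, w3} \<in> knight_graph n - switch R G"
    using sw disj switch_rail(6)[OF GK R eq km]
    by (auto simp: switch_def eq eq' doubleton_eq_iff)
  then show ?thesis
    using eq' km' parallel_sides[OF km'] unfolding rails_def by blast
qed

text \<open>This is the induction step both for switching a list of rails and for the program loop
  that does so.\<close>

lemma disjoint_rails_switch:
  assumes GK: "G \<subseteq> knight_graph n" and disj: "disjoint_rails n G (set (R # Rs))"
    and "distinct (R # Rs)"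
  shows "disjoint_rails n (switch R G) (set Rs)"
proof -
  have "R' \<in> rails n (switch R G)" if "R' \<in> set Rs" for R'
  proof (rule rails_switch_disjoint[OF GK])
    show "R \<in> rails n G" "R' \<in> rails n G" "\<Union>R \<inter> \<Union>R' = {}"
      using that assms unfolding disjoint_rails_def by (force, force, metis distinct.simps(2) list.set_intros)
  qed
  then show ?thesis
    using disj by (auto simp: disjoint_rails_def)
qed

lemma two_regular_fold_switch:
  assumes "two_regular n G" "disjoint_rails n G (set Rs)" "distinct Rs"
  shows "two_regular n (fold switch Rs G)"
  using assms
proof (induction Rs arbitrary: G)
  case Nil
  then show ?case by simp
next
  case (Cons R Rs)
  have "two_regular n (switch R G)"
    using Cons.prems by (intro two_regular_switch) (auto simp: disjoint_rails_def)
  moreover have "disjoint_rails n (switch R G) (set Rs)"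
    using Cons.prems by (intro disjoint_rails_switch) (auto simp: two_regular_def)
  ultimately show ?case
    using Cons by simp
qed

text \<open>One cell chosen from each rail gives an injection into the board. This bounds the number
  of iterations of the switching loop.\<close>

lemma length_disjoint_rails:
  assumes "two_regular n G" "disjoint_rails n G (set Rs)" "distinct Rs"
  shows "length Rs \<le> n\<^sup>2"
proof -
  have GK: "G \<subseteq> knight_graph n"
    using assms(1) by (simp add: two_regular_def)
  have "\<exists>v. v \<in> \<Union>R \<and> v \<in> board n" if R: "R \<in> set Rs" for R
  proof -
    have R': "R \<in> rails n G"
      using R assms(2) by (auto simp: disjoint_rails_def)
    obtain v0 v1 v2 v3 where eq: "R = {{v0, v1}, {v2, v3}}" and km: "km v0 v1 = km v2 v3"
      using rail_cases[OF R'] .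
    show ?thesis
      using switch_rail(1)[OF GK R' eq km] GK knight_graphD(1) unfolding eq by blast
  qed
  then obtain f where f: "\<And>R. R \<in> set Rs \<Longrightarrow> f R \<in> \<Union>R \<and> f R \<in> board n"
    by metis
  have "inj_on f (set Rs)"
    using f assms(2) unfolding inj_on_def disjoint_rails_def by (metis IntI empty_iff)
  then have "card (set Rs) \<le> card (board n)"
    using f by (intro card_inj_on_le[of f]) (auto simp: finite_board)
  then show ?thesis
    using assms(3) by (simp add: card_board distinct_card)
qed

text \<open>A rail of a larger disjoint family meets some member of D, which belongs to that family
  too, so the two coincide. Maximality thus becomes a condition on single rails, which marks can
  certify.\<close>

lemma maximal_disjoint_railsI:
  assumes "disjoint_rails n G D" "\<And>R. R \<in> rails n G \<Longrightarrow> \<Union>R \<inter> \<Union>(\<Union>D) \<noteq> {}"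
  shows "maximal_disjoint_rails n G D"
  unfolding maximal_disjoint_rails_def
proof (intro conjI allI impI assms(1))
  fix D'
  assume D': "disjoint_rails n G D' \<and> D \<subseteq> D'"
  have "R \<in> D" if R: "R \<in> D'" for R
  proof -
    have "\<Union>R \<inter> \<Union>(\<Union>D) \<noteq> {}"
      using assms(2) R D' by (simp add: disjoint_rails_def subset_iff)
    then obtain R' where R': "R' \<in> D" "\<Union>R \<inter> \<Union>R' \<noteq> {}"
      by blast
    then have "R = R'"
      using R D' unfolding disjoint_rails_def by (metis subsetD)
    then show ?thesis
      using R' by simp
  qed
  then show "D' = D"
    using D' by blast
qed

subsection \<open>Running time of programs without nested loops\<close>

text \<open>All three loops of the program have bodies of this kind, so one pass through a body
  costs at most a constant.\<close>

primrec loop_free :: "com \<Rightarrow> bool" where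
  "loop_free Skip \<longleftrightarrow> True"
| "loop_free (Assign x e) \<longleftrightarrow> True"
| "loop_free (Store a i e) \<longleftrightarrow> True"
| "loop_free (Seq c d) \<longleftrightarrow> loop_free c \<and> loop_free d"
| "loop_free (If b c d) \<longleftrightarrow> loop_free c \<and> loop_free d"
| "loop_free (While b c) \<longleftrightarrow> False"

text \<open>The values at loops are irrelevant.\<close>

primrec exec :: "com \<Rightarrow> store \<Rightarrow> store" where
  "exec Skip s = s"
| "exec (Assign x e) s = s\<lparr>reg := (reg s)(x := aval e s)\<rparr>"
| "exec (Store a i e) s = s\<lparr>arr := (arr s)(a := (arr s a)(aval i s := aval e s))\<rparr>"
| "exec (Seq c d) s = exec d (exec c s)"
| "exec (If b c d) s = (if bval b s then exec c s else exec d s)"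
| "exec (While b c) s = s"

text \<open>Both branches of a conditional are charged, which keeps the bound independent of the
  store.\<close>

primrec cost_bound :: "com \<Rightarrow> nat" where
  "cost_bound Skip = 1"
| "cost_bound (Assign x e) = 1 + acost e"
| "cost_bound (Store a i e) = 1 + acost i + acost e"
| "cost_bound (Seq c d) = cost_bound c + cost_bound d"
| "cost_bound (If b c d) = 1 + bcost b + (cost_bound c + cost_bound d)"
| "cost_bound (While b c) = 0"

lemma exec_runs:
  assumes "loop_free c"
  shows "\<exists>t\<le>cost_bound c. runs c s t (exec c s)"
  using assms
proof (induction c arbitrary: s)
  case Skip
  then show ?case using runs.Skip by auto
next
  case (Assign x e)
  then show ?case using runs.Assign by auto
next
  case (Store a i e)
  then show ?case using runs.Store by auto
next
  case (Seq c d)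
  obtain t where "t \<le> cost_bound c" "runs c s t (exec c s)"
    using Seq by auto
  moreover obtain t' where "t' \<le> cost_bound d" "runs d (exec c s) t' (exec d (exec c s))"
    using Seq by fastforce
  ultimately show ?case
    by (intro exI[of _ "t + t'"]) (auto intro: runs.Seq)
next
  case (If b c d)
  show ?case
  proof (cases "bval b s")
    case True
    obtain t where "t \<le> cost_bound c" "runs c s t (exec c s)"
      using If by auto
    then show ?thesis
      using True runs.IfTrue[OF True] by (intro exI[of _ "1 + bcost b + t"]) auto
  next
    case False
    obtain t where "t \<le> cost_bound d" "runs d s t (exec d s)"
      using If by auto
    then show ?thesis
      using False runs.IfFalse[OF False] by (intro exI[of _ "1 + bcost b + t"]) auto
  qed
next
  case (While b c)
  then show ?case by simp
qed

text \<open>A total-correctness triple with a time bound, for a fixed start store.\<close>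

definition ends :: "com \<Rightarrow> store \<Rightarrow> nat \<Rightarrow> (store \<Rightarrow> bool) \<Rightarrow> bool" where
  "ends c s B Q \<longleftrightarrow> (\<exists>t s'. runs c s t s' \<and> t \<le> B \<and> Q s')"

lemma ends_loop_free:
  assumes "loop_free c" "Q (exec c s)"
  shows "ends c s (cost_bound c) Q"
  using exec_runs[OF assms(1), of s] assms(2) unfolding ends_def by blast

lemma ends_Seq:
  assumes "ends c s B P" "\<And>s'. P s' \<Longrightarrow> ends d s' B' Q"
  shows "ends (Seq c d) s (B + B') Q"
  using assms unfolding ends_def by (meson add_mono runs.Seq)

lemma ends_mono:
  assumes "ends c s B P" "B \<le> B'" "\<And>s'. P s' \<Longrightarrow> Q s'"
  shows "ends c s B' Q"
  using assms unfolding ends_def by (meson le_trans)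

text \<open>The measure bounds the number of iterations; the extra unit in \<open>Suc (m s)\<close>
  pays for the final failing test.\<close>

lemma ends_While:
  assumes "loop_free c"
    and "\<And>s. I s \<Longrightarrow> bval b s \<Longrightarrow> I (exec c s) \<and> m (exec c s) < m s"
    and "I s"
  shows "ends (While b c) s (Suc (m s) * (1 + bcost b + cost_bound c)) (\<lambda>s'. I s' \<and> \<not> bval b s')"
  using assms(3)
proof (induction "m s" arbitrary: s rule: less_induct)
  case less
  let ?K = "1 + bcost b + cost_bound c"
  show ?case
  proof (cases "bval b s")
    case True
    obtain t where t: "t \<le> cost_bound c" "runs c s t (exec c s)"
      using exec_runs[OF assms(1)] by blast
    have step: "I (exec c s)" "m (exec c s) < m s"
      using assms(2)[OF less.prems True] by auto
    obtain t' s' where s': "runs (While b c) (exec c s) t' s'" "I s'" "\<not> bval b s'"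
      and t': "t' \<le> Suc (m (exec c s)) * ?K"
      using less.hyps[OF step(2,1)] by (auto simp: ends_def)
    have "Suc (m (exec c s)) * ?K \<le> m s * ?K"
      using step(2) by (intro mult_right_mono) auto
    then have "1 + bcost b + t + t' \<le> Suc (m s) * ?K"
      using t t' by simp
    then show ?thesis
      unfolding ends_def using runs.WhileTrue[OF True t(2) s'(1)] s' by blast
  next
    case False
    then show ?thesis
      unfolding ends_def using runs.WhileFalse[OF False] less.prems
      by (intro exI[of _ "1 + bcost b"] exI[of _ s]) auto
  qed
qed

subsection \<open>Stored adjacency lists\<close>

text \<open>Division is confined to the proofs; no program evaluates it.\<close>

definition decode :: "nat \<Rightarrow> int \<Rightarrow> cell" where
  "decode n c = (c div int n, c mod int n)"

lemma decode_code: "v \<in> board n \<Longrightarrow> decode n (code n v) = v"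
  by (cases v) (auto simp: board_def decode_def code_def)

lemma code_eq_iff: "v \<in> board n \<Longrightarrow> w \<in> board n \<Longrightarrow> code n v = code n w \<longleftrightarrow> v = w"
  by (metis decode_code)

lemma code_bounds:
  assumes "v \<in> board n"
  shows "0 \<le> code n v" "code n v < int n * int n"
proof -
  have v: "0 \<le> fst v" "fst v + 1 \<le> int n" "0 \<le> snd v" "snd v < int n"
    using assms by (auto simp: board_def)
  show "0 \<le> code n v"
    using v by (simp add: code_def)
  have "(fst v + 1) * int n \<le> int n * int n"
    using v by (intro mult_right_mono) auto
  then show "code n v < int n * int n"
    using v by (simp add: code_def algebra_simps)
qed

lemma code_decode: "code n (decode n c) = c"
  by (simp add: code_def decode_def)

lemma decode_in_board:
  assumes "0 \<le> c" "c < int n * int n"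
  shows "decode n c \<in> board n"
proof -
  have "0 < int n"
    using assms by (cases n) auto
  moreover have "c div int n < int n"
  proof (rule ccontr)
    assume "\<not> c div int n < int n"
    then have "int n * int n \<le> c div int n * int n"
      by (intro mult_right_mono) auto
    also have "\<dots> \<le> c"
      using \<open>0 < int n\<close> by (metis div_mult_mod_eq le_add_same_cancel1 pos_mod_sign)
    finally show False
      using assms by simp
  qed
  ultimately show ?thesis
    using assms by (simp add: decode_def board_def pos_imp_zdiv_nonneg_iff)
qed

text \<open>N is an arbitrary neighbour function and need not be symmetric, so this also describes
  the store halfway through a switch. As degrees are two, the slots 0 and 1 of each block carry the
  list.\<close>

definition stores_nbrs :: "nat \<Rightarrow> (cell \<Rightarrow> cell set) \<Rightarrow> store \<Rightarrow> bool" where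
  "stores_nbrs n N s \<longleftrightarrow> reg s ''n'' = int n \<and>
    (\<forall>v\<in>board n. \<exists>x\<in>board n. \<exists>y\<in>board n. N v = {x, y} \<and> x \<noteq> y \<and> arr s ''deg'' (code n v) = 2 \<and>
      arr s ''adj'' (8 * code n v) = code n x \<and> arr s ''adj'' (8 * code n v + 1) = code n y)"

text \<open>Codes are injective on the board, so a duplicate-free list for two neighbours has
  exactly two entries. Their order is left open, hence the two cases.\<close>

lemma stores_graph_iff:
  assumes reg: "two_regular n G"
  shows "stores_graph n G s \<longleftrightarrow> stores_nbrs n (nbrs G) s"
proof
  have GK: "G \<subseteq> knight_graph n" and card2: "\<And>u. u \<in> board n \<Longrightarrow> card (nbrs G u) = 2"
    using reg by (auto simp: two_regular_def)
  have list2: "adj_list n s v = [arr s ''adj'' (8 * code n v), arr s ''adj'' (8 * code n v + 1)]"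
    if "arr s ''deg'' (code n v) = 2" for v
    using that by (simp add: adj_list_def upt_rec)
  {
    assume G: "stores_graph n G s"
    show "stores_nbrs n (nbrs G) s"
      unfolding stores_nbrs_def
    proof (intro conjI ballI)
      show "reg s ''n'' = int n"
        using G by (simp add: stores_graph_def)
      fix v
      assume v: "v \<in> board n"
      have d: "distinct (adj_list n s v)" and set: "set (adj_list n s v) = code n ` nbrs G v"
        using G v by (auto simp: stores_graph_def nbrs_def)
      obtain x y where xy: "nbrs G v = {x, y}" "x \<noteq> y"
        using card2[OF v] unfolding card_2_iff by blast
      have xyb: "x \<in> board n" "y \<in> board n"
        using nbrs_subset_board[OF GK, of v] xy by blast+
      have ne: "code n x \<noteq> code n y"
        using code_eq_iff xyb xy(2) by blast
      have "length (adj_list n s v) = 2"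
        using distinct_card[OF d] set xy ne by simp
      then have deg: "arr s ''deg'' (code n v) = 2"
        by (simp add: adj_list_def)
      have "{arr s ''adj'' (8 * code n v), arr s ''adj'' (8 * code n v + 1)} = {code n x, code n y}"
        using set list2[OF deg] xy by simp
      then consider
        "arr s ''adj'' (8 * code n v) = code n x" "arr s ''adj'' (8 * code n v + 1) = code n y"
      | "arr s ''adj'' (8 * code n v) = code n y" "arr s ''adj'' (8 * code n v + 1) = code n x"
        by (auto simp: doubleton_eq_iff)
      then show "\<exists>x\<in>board n. \<exists>y\<in>board n. nbrs G v = {x, y} \<and> x \<noteq> y \<and>
          arr s ''deg'' (code n v) = 2 \<and> arr s ''adj'' (8 * code n v) = code n x \<and>
          arr s ''adj'' (8 * code n v + 1) = code n y"
      proof cases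
        case 1
        then show ?thesis
          using xy xyb deg by (intro bexI[of _ x] bexI[of _ y]) auto
      next
        case 2
        then show ?thesis
          using xy xyb deg by (intro bexI[of _ y] bexI[of _ x]) auto
      qed
    qed
  next
    assume N: "stores_nbrs n (nbrs G) s"
    show "stores_graph n G s"
      unfolding stores_graph_def
    proof (intro conjI ballI)
      show "reg s ''n'' = int n"
        using N by (simp add: stores_nbrs_def)
      fix v
      assume v: "v \<in> board n"
      obtain x y where xy: "x \<in> board n" "y \<in> board n" "nbrs G v = {x, y}" "x \<noteq> y"
        "arr s ''deg'' (code n v) = 2"
        "arr s ''adj'' (8 * code n v) = code n x" "arr s ''adj'' (8 * code n v + 1) = code n y"
        using N v unfolding stores_nbrs_def by blast
      have "code n x \<noteq> code n y"
        using code_eq_iff xy by blast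
      then show "distinct (adj_list n s v)"
        using list2 xy by simp
      show "set (adj_list n s v) = code n ` {w. {v, w} \<in> G}"
        using list2 xy by (simp flip: nbrs_def)
    qed
  }
qed

text \<open>Eight times a value by three doublings, as the machine does not multiply.\<close>

definition slot :: "aexp \<Rightarrow> int \<Rightarrow> aexp" where
  "slot e k = Plus (let d = Plus e e; q = Plus d d in Plus q q) (Lit k)"

lemma aval_slot [simp]: "aval (slot e k) s = 8 * aval e s + k"
  by (simp add: slot_def Let_def)

definition quad :: "aexp \<Rightarrow> int \<Rightarrow> aexp" where
  "quad e k = Plus (let d = Plus e e in Plus d d) (Lit k)"

lemma aval_quad [simp]: "aval (quad e k) s = 4 * aval e s + k"
  by (simp add: quad_def Let_def)

subsection \<open>Constructing a maximal set of rails\<close>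

definition init_step :: com where
  "init_step =
    Seq (Store ''row'' (Reg ''c'') (Reg ''i''))
    (Seq (Store ''col'' (Reg ''c'') (Reg ''j''))
    (Seq (Store ''mark'' (Reg ''c'') (Lit 0))
    (Seq (Assign ''c'' (Plus (Reg ''c'') (Lit 1)))
    (Seq (Assign ''j'' (Plus (Reg ''j'') (Lit 1)))
    (If (Equal (Reg ''j'') (Reg ''n''))
       (Seq (Assign ''j'' (Lit 0)) (Assign ''i'' (Plus (Reg ''i'') (Lit 1))))
       Skip)))))"

text \<open>That \<open>j\<close> is 0 once \<open>i\<close> reaches n pins \<open>c\<close> to the
  square of n at the exit; this number, obtained by counting, then bounds the scan. A and B record
  that the adjacency data stay untouched.\<close>

definition init_inv :: "nat \<Rightarrow> (int \<Rightarrow> int) \<Rightarrow> (int \<Rightarrow> int) \<Rightarrow> store \<Rightarrow> bool" where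
  "init_inv n A B s \<longleftrightarrow> reg s ''n'' = int n \<and> reg s ''d'' = 0 \<and>
    arr s ''adj'' = A \<and> arr s ''deg'' = B \<and>
    0 \<le> reg s ''i'' \<and> reg s ''i'' \<le> int n \<and> 0 \<le> reg s ''j'' \<and> reg s ''j'' < int n \<and>
    (reg s ''i'' = int n \<longrightarrow> reg s ''j'' = 0) \<and>
    reg s ''c'' = reg s ''i'' * int n + reg s ''j'' \<and>
    (\<forall>v\<in>board n. code n v < reg s ''c'' \<longrightarrow>
      arr s ''row'' (code n v) = fst v \<and> arr s ''col'' (code n v) = snd v \<and>
      arr s ''mark'' (code n v) = 0)"

lemma init_step_inv:
  assumes inv: "init_inv n A B s" and lt: "reg s ''i'' < int n"
  shows "init_inv n A B (exec init_step s)" "reg (exec init_step s) ''c'' = reg s ''c'' + 1"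
    "reg s ''c'' < int n * int n"
proof -
  let ?i = "reg s ''i''" and ?j = "reg s ''j''" and ?c = "reg s ''c''"
  have s: "reg s ''n'' = int n" "0 \<le> ?i" "0 \<le> ?j" "?j < int n" "?c = ?i * int n + ?j"
    using inv by (auto simp: init_inv_def)
  have ij: "(?i, ?j) \<in> board n" "code n (?i, ?j) = ?c"
    using s lt by (auto simp: board_def code_def)
  then show "?c < int n * int n"
    using code_bounds(2) by metis
  \<comment> \<open>By injectivity of codes, the only cell newly below the bound is the current
    one.\<close>
  have cells: "v = (?i, ?j) \<or> code n v < ?c" if "v \<in> board n" "code n v < ?c + 1" for v
    using that ij code_eq_iff[OF that(1) ij(1)] by auto

  have new: "arr (exec init_step s) ''row'' = (arr s ''row'')(?c := ?i)"
    "arr (exec init_step s) ''col'' = (arr s ''col'')(?c := ?j)"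
    "arr (exec init_step s) ''mark'' = (arr s ''mark'')(?c := 0)"
    "arr (exec init_step s) ''adj'' = arr s ''adj''" "arr (exec init_step s) ''deg'' = arr s ''deg''"
    "reg (exec init_step s) ''n'' = reg s ''n''" "reg (exec init_step s) ''d'' = reg s ''d''"
    "reg (exec init_step s) ''c'' = ?c + 1"
    "reg (exec init_step s) ''j'' = (if ?j + 1 = reg s ''n'' then 0 else ?j + 1)"
    "reg (exec init_step s) ''i'' = (if ?j + 1 = reg s ''n'' then ?i + 1 else ?i)"
    by (simp_all add: init_step_def)
  have filled: "\<forall>v\<in>board n. code n v < ?c + 1 \<longrightarrow>
      arr (exec init_step s) ''row'' (code n v) = fst v \<and>
      arr (exec init_step s) ''col'' (code n v) = snd v \<and>
      arr (exec init_step s) ''mark'' (code n v) = 0"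
  proof (intro ballI impI)
    fix v
    assume v: "v \<in> board n" "code n v < ?c + 1"
    then show "arr (exec init_step s) ''row'' (code n v) = fst v \<and>
      arr (exec init_step s) ''col'' (code n v) = snd v \<and>
      arr (exec init_step s) ''mark'' (code n v) = 0"
      using cells[OF v] inv ij(2) unfolding new init_inv_def by auto
  qed
  show "reg (exec init_step s) ''c'' = ?c + 1"
    by (fact new)
  have "(?i + 1) * int n = ?i * int n + int n"
    by (simp add: algebra_simps)
  then show "init_inv n A B (exec init_step s)"
    unfolding init_inv_def new(4-) using inv lt s
    by (intro conjI filled) (auto simp: init_inv_def)
qed

section \<open>Programs that probe for a single rail\<close>

text \<open>The move is fixed in the program text, so a multiple of n unfolds into sums of the
  register; the last branch serves a = -2.\<close>

definition scaled :: "int \<Rightarrow> aexp" where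
  "scaled a = (if a = 1 then Reg ''n'' else if a = 2 then Plus (Reg ''n'') (Reg ''n'')
    else if a = - 1 then Minus (Lit 0) (Reg ''n'') else Minus (Lit 0) (Plus (Reg ''n'') (Reg ''n'')))"

lemma aval_scaled:
  assumes "(a, b) \<in> knight_moves"
  shows "aval (scaled a) s = a * reg s ''n''"
proof -
  have "a \<in> {1, 2, - 1, - 2}"
    using assms by (auto simp: knight_moves_def)
  then show ?thesis
    by (auto simp: scaled_def)
qed

text \<open>The registers \<open>v\<close>, \<open>x\<close>, \<open>w\<close>, \<open>y\<close> hold the codes of \<open>v\<^sub>0\<close>, \<open>v\<^sub>1\<close>, \<open>v\<^sub>2\<close>, \<open>v\<^sub>3\<close>. If \<open>v\<^sub>2\<close> is off the board,
  then \<open>w\<close> and \<open>y\<close> are junk, and the first four conditions reject.\<close>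

definition rail_test :: "int \<Rightarrow> int \<Rightarrow> bexp" where
  "rail_test a b = foldr And
    [Less (Lit (- 1)) (Plus (Arr ''row'' (Reg ''v'')) (Lit a)),
     Less (Plus (Arr ''row'' (Reg ''v'')) (Lit a)) (Reg ''n''),
     Less (Lit (- 1)) (Plus (Arr ''col'' (Reg ''v'')) (Lit b)),
     Less (Plus (Arr ''col'' (Reg ''v'')) (Lit b)) (Reg ''n''),
     Equal (Minus (Arr ''row'' (Reg ''x'')) (Arr ''row'' (Reg ''v'')))
       (Minus (Arr ''row'' (Reg ''y'')) (Arr ''row'' (Reg ''w''))),
     Equal (Minus (Arr ''col'' (Reg ''x'')) (Arr ''col'' (Reg ''v'')))
       (Minus (Arr ''col'' (Reg ''y'')) (Arr ''col'' (Reg ''w''))),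
     Not (Equal (Arr ''adj'' (slot (Reg ''v'') 0)) (Reg ''w'')),
     Not (Equal (Arr ''adj'' (slot (Reg ''v'') 1)) (Reg ''w'')),
     Not (Equal (Arr ''adj'' (slot (Reg ''x'') 0)) (Reg ''y'')),
     Not (Equal (Arr ''adj'' (slot (Reg ''x'') 1)) (Reg ''y'')),
     Equal (Arr ''mark'' (Reg ''v'')) (Lit 0), Equal (Arr ''mark'' (Reg ''x'')) (Lit 0),
     Equal (Arr ''mark'' (Reg ''w'')) (Lit 0)]
    (Equal (Arr ''mark'' (Reg ''y'')) (Lit 0))"

definition record_rail :: com where
  "record_rail =
    Seq (Store ''rails'' (quad (Reg ''d'') 0) (Reg ''v''))
    (Seq (Store ''rails'' (quad (Reg ''d'') 1) (Reg ''x''))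
    (Seq (Store ''rails'' (quad (Reg ''d'') 2) (Reg ''w''))
    (Seq (Store ''rails'' (quad (Reg ''d'') 3) (Reg ''y''))
    (Seq (Assign ''d'' (Plus (Reg ''d'') (Lit 1)))
    (Seq (Store ''mark'' (Reg ''v'') (Lit 1))
    (Seq (Store ''mark'' (Reg ''x'') (Lit 1))
    (Seq (Store ''mark'' (Reg ''w'') (Lit 1))
    (Store ''mark'' (Reg ''y'') (Lit 1)))))))))"

text \<open>Here k is the slot of v1 in the list of v0, and l the slot of v3 in the list of
  v2.\<close>

definition probe :: "(int \<times> int) \<times> (int \<times> int) \<Rightarrow> com" where
  "probe = (\<lambda>((a, b), (k, l)).
    Seq (Assign ''w'' (Plus (Reg ''v'') (Plus (scaled a) (Lit b))))
    (Seq (Assign ''x'' (Arr ''adj'' (slot (Reg ''v'') k)))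
    (Seq (Assign ''y'' (Arr ''adj'' (slot (Reg ''w'') l)))
    (If (rail_test a b) record_rail Skip))))"

definition probes :: "((int \<times> int) \<times> (int \<times> int)) list" where
  "probes = List.product
    [(1, 2), (1, - 2), (- 1, 2), (- 1, - 2), (2, 1), (2, - 1), (- 2, 1), (- 2, - 1)]
    (List.product [0, 1] [0, 1])"

definition probe_all :: "((int \<times> int) \<times> (int \<times> int)) list \<Rightarrow> com" where
  "probe_all ps = foldr (\<lambda>p. Seq (probe p)) ps Skip"

definition scan_step :: com where
  "scan_step = Seq (probe_all probes) (Assign ''v'' (Plus (Reg ''v'') (Lit 1)))"

lemma set_probes: "set probes = knight_moves \<times> ({0, 1} \<times> {0, 1})"
proof -
  have "(a, b) \<in> knight_moves \<longleftrightarrow>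
      (a = 1 \<or> a = - 1) \<and> (b = 2 \<or> b = - 2) \<or> (a = 2 \<or> a = - 2) \<and> (b = 1 \<or> b = - 1)" for a b
    by (simp add: knight_moves_def abs_eq_iff')
  then have "knight_moves =
      {(1, 2), (1, - 2), (- 1, 2), (- 1, - 2), (2, 1), (2, - 1), (- 2, 1), (- 2, - 1)}"
    by (simp add: set_eq_iff) blast
  then show ?thesis
    by (simp only: probes_def set_product list.set)
qed

lemma loop_free_probe_all: "loop_free (probe_all ps)"
  by (induction ps) (auto simp: probe_all_def probe_def record_rail_def)

section \<open>Invariant of the scan and maximality of its result\<close>

definition move :: "cell \<Rightarrow> int \<times> int \<Rightarrow> cell" where
  "move u m = (fst u + fst m, snd u + snd m)"

definition marked :: "rail list \<Rightarrow> cell set" where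
  "marked Rs = \<Union>(\<Union>(set Rs))"

text \<open>The scan never writes the adjacency array, so its contents A are fixed once, together
  with \<open>nb k v\<close>, the cell in slot k of the list of v.\<close>

locale stored_tour =
  fixes n :: nat and G :: graph and A :: "int \<Rightarrow> int" and nb :: "int \<Rightarrow> cell \<Rightarrow> cell"
  assumes GK: "G \<subseteq> knight_graph n"
    and nbrs_eq: "v \<in> board n \<Longrightarrow> nbrs G v = {nb 0 v, nb 1 v}"
    and adj_eq: "v \<in> board n \<Longrightarrow> k \<in> {0, 1} \<Longrightarrow> A (8 * code n v + k) = code n (nb k v)"
begin

lemma nb_nbrs: "v \<in> board n \<Longrightarrow> k \<in> {0, 1} \<Longrightarrow> nb k v \<in> nbrs G v"
  using nbrs_eq by auto

lemma nb_board: "v \<in> board n \<Longrightarrow> k \<in> {0, 1} \<Longrightarrow> nb k v \<in> board n"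
  using nb_nbrs nbrs_subset_board[OF GK] by blast



text \<open>Tying the marks to the recorded rails lets four lookups decide disjointness from all of
  them.\<close>

definition scan_inv :: "(int \<Rightarrow> int) \<Rightarrow> rail list \<Rightarrow> store \<Rightarrow> bool" where
  "scan_inv B Rs s \<longleftrightarrow> reg s ''n'' = int n \<and> reg s ''c'' = int n * int n \<and>
    arr s ''adj'' = A \<and> arr s ''deg'' = B \<and>
    (\<forall>v\<in>board n. arr s ''row'' (code n v) = fst v \<and> arr s ''col'' (code n v) = snd v \<and>
      arr s ''mark'' (code n v) = (if v \<in> marked Rs then 1 else 0)) \<and>
    stores_rails n Rs s \<and> distinct Rs \<and> disjoint_rails n G (set Rs)"

text \<open>Older entries occupy indices below four times the length, so the four writes spare
  them.\<close>

lemma stores_rails_snoc: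
  assumes "stores_rails n Rs s" "R = {{v0, v1}, {v2, v3}}" "km v0 v1 = km v2 v3"
    and "reg s' ''d'' = reg s ''d'' + 1"
    and arr': "arr s' ''rails'' = (arr s ''rails'')
      (4 * reg s ''d'' := code n v0, 4 * reg s ''d'' + 1 := code n v1,
       4 * reg s ''d'' + 2 := code n v2, 4 * reg s ''d'' + 3 := code n v3)"
  shows "stores_rails n (Rs @ [R]) s'"
  unfolding stores_rails_def
proof (intro conjI allI impI)
  have d: "reg s ''d'' = int (length Rs)"
    using assms(1) by (simp add: stores_rails_def)
  then show "reg s' ''d'' = int (length (Rs @ [R]))"
    using assms(4) by simp
  fix i
  assume i: "i < length (Rs @ [R])"
  show "\<exists>v0 v1 v2 v3. (Rs @ [R]) ! i = {{v0, v1}, {v2, v3}} \<and> km v0 v1 = km v2 v3 \<and>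
      arr s' ''rails'' (4 * int i) = code n v0 \<and> arr s' ''rails'' (4 * int i + 1) = code n v1 \<and>
      arr s' ''rails'' (4 * int i + 2) = code n v2 \<and> arr s' ''rails'' (4 * int i + 3) = code n v3"
  proof (cases "i < length Rs")
    case True
    then have "arr s' ''rails'' (4 * int i + k) = arr s ''rails'' (4 * int i + k)"
      if "k \<in> {0, 1, 2, 3}" for k
    proof -
      have "4 * int i + k < 4 * int (length Rs)"
        using that True by auto
      then show ?thesis
        unfolding arr' d by simp
    qed
    from this[of 0] this[of 1] this[of 2] this[of 3] show ?thesis
      using True assms(1) by (simp add: stores_rails_def nth_append)
  next
    case False
    then have "i = length Rs"
      using i by simp
    then show ?thesis
      unfolding arr' d using assms(2,3)
      by (intro exI[of _ v0] exI[of _ v1] exI[of _ v2] exI[of _ v3]) simp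
  qed
qed

text \<open>Unmarked cells make the new rail disjoint from every recorded one; in particular it is
  not among them, since a rail shares cells with itself.\<close>

lemma record_rail_inv:
  assumes inv: "scan_inv B Rs s"
    and regs: "reg s ''v'' = code n v0" "reg s ''x'' = code n v1"
      "reg s ''w'' = code n v2" "reg s ''y'' = code n v3"
    and board: "v0 \<in> board n" "v1 \<in> board n" "v2 \<in> board n" "v3 \<in> board n"
    and R: "R \<in> rails n G" "R = {{v0, v1}, {v2, v3}}" "km v0 v1 = km v2 v3"
    and free: "{v0, v1, v2, v3} \<inter> marked Rs = {}"
  shows "scan_inv B (Rs @ [R]) (exec record_rail s)"
    "reg (exec record_rail s) ''v'' = reg s ''v''"
proof -
  let ?s = "exec record_rail s"
  show "reg ?s ''v'' = reg s ''v''"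
    by (simp add: record_rail_def)
  have cells: "\<Union>R = {v0, v1, v2, v3}"
    unfolding R(2) by blast
  have marked: "marked (Rs @ [R]) = marked Rs \<union> {v0, v1, v2, v3}"
    using cells by (simp add: marked_def Un_commute)
  have "stores_rails n (Rs @ [R]) ?s"
    using inv regs R(2,3) by (intro stores_rails_snoc[of Rs s]) (auto simp: scan_inv_def record_rail_def)
  moreover have "arr ?s ''mark'' (code n v) = (if v \<in> marked (Rs @ [R]) then 1 else 0)"
    if "v \<in> board n" for v
  proof -
    have "arr ?s ''mark'' = (arr s ''mark'')
        (code n v0 := 1, code n v1 := 1, code n v2 := 1, code n v3 := 1)"
      using regs by (simp add: record_rail_def)
    then have "arr ?s ''mark'' (code n v) =
        (if v = v0 \<or> v = v1 \<or> v = v2 \<or> v = v3 then 1 else arr s ''mark'' (code n v))"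
      using code_eq_iff[OF that] board by simp
    then show ?thesis
      using inv that unfolding marked by (simp add: scan_inv_def)
  qed
  moreover have disj: "\<Union>R \<inter> \<Union>R' = {}" if "R' \<in> set Rs" for R'
    using that free unfolding cells marked_def by blast
  moreover have "R \<notin> set Rs"
  proof
    assume "R \<in> set Rs"
    then show False
      using disj[of R] cells by simp
  qed
  moreover have "disjoint_rails n G (set (Rs @ [R]))"
    using inv R(1) disj unfolding scan_inv_def disjoint_rails_def by (simp add: Int_commute)
  ultimately show "scan_inv B (Rs @ [R]) ?s"
    using inv unfolding scan_inv_def by (simp add: record_rail_def)
qed



text \<open>The part of being a rail that the program tests. That v0 v1 and v2 v3 are edges of G and
  that v0 to v2 is a knight move holds by the way the cells are produced.\<close>

definition candidate :: "cell \<Rightarrow> cell \<Rightarrow> cell \<Rightarrow> cell \<Rightarrow> bool" where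
  "candidate v0 v1 v2 v3 \<longleftrightarrow> v2 \<in> board n \<and> km v0 v1 = km v2 v3 \<and>
    v2 \<notin> nbrs G v0 \<and> v3 \<notin> nbrs G v1"

text \<open>Either the probe yields no rail, or that rail shares a cell with a recorded one. Marks
  never disappear, so this persists while the scan goes on.\<close>

definition covered :: "rail list \<Rightarrow> cell \<Rightarrow> (int \<times> int) \<times> (int \<times> int) \<Rightarrow> bool" where
  "covered Rs u = (\<lambda>(m, (k, l)).
    candidate u (nb k u) (move u m) (nb l (move u m)) \<longrightarrow>
    {u, nb k u, move u m, nb l (move u m)} \<inter> marked Rs \<noteq> {})"

lemma covered_mono: "covered Rs u p \<Longrightarrow> set Rs \<subseteq> set Rs' \<Longrightarrow> covered Rs' u p"
  unfolding covered_def marked_def by (cases p) (auto simp only: prod.case; blast)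

text \<open>The tables turn differences of rows and columns into displacements, and injective codes
  turn slot comparisons into non-adjacency. If the move leaves the board, a range check fails, so
  nothing is assumed about \<open>y\<close> in that case.\<close>

lemma rail_test_iff:
  assumes inv: "scan_inv B Rs s" and u: "u \<in> board n" and v1: "v1 \<in> board n"
    and v3: "move u (a, b) \<in> board n \<Longrightarrow> v3 \<in> board n"
    and regs: "reg s ''v'' = code n u" "reg s ''x'' = code n v1"
      "reg s ''w'' = code n (move u (a, b))"
      "move u (a, b) \<in> board n \<Longrightarrow> reg s ''y'' = code n v3"
  shows "bval (rail_test a b) s \<longleftrightarrow>
    candidate u v1 (move u (a, b)) v3 \<and> {u, v1, move u (a, b), v3} \<inter> marked Rs = {}"
proof (cases "move u (a, b) \<in> board n")
  case True
  have A: "A (8 * code n v) = code n (nb 0 v)" "A (8 * code n v + 1) = code n (nb 1 v)"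
    if "v \<in> board n" for v
    using adj_eq[OF that, of 0] adj_eq[OF that, of 1] by auto
  have nonadj: "x \<notin> nbrs G v \<longleftrightarrow> A (8 * code n v) \<noteq> code n x \<and> A (8 * code n v + 1) \<noteq> code n x"
    if "v \<in> board n" "x \<in> board n" for v x
    using that A nbrs_eq nb_board code_eq_iff by auto
  have bounds: "- 1 < fst u + a \<and> fst u + a < int n \<and> - 1 < snd u + b \<and> snd u + b < int n"
    using True by (auto simp: move_def board_def)
  show ?thesis
    using inv True u v1 v3[OF True] regs(1-3) regs(4)[OF True] bounds
    unfolding candidate_def nonadj[OF u True] nonadj[OF v1 v3[OF True]]
    by (auto simp: rail_test_def scan_inv_def km_def)
next
  case False
  then have "\<not> (- 1 < fst u + a \<and> fst u + a < int n \<and> - 1 < snd u + b \<and> snd u + b < int n)"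
    by (auto simp: move_def board_def)
  then have "\<not> bval (rail_test a b) s"
    using inv u regs(1) by (auto simp: rail_test_def scan_inv_def)
  then show ?thesis
    using False by (simp add: candidate_def)
qed

text \<open>The parallelogram makes the second new edge a knight move as well; its ends are on the
  board as neighbours in G.\<close>

lemma candidate_rail:
  assumes "candidate u v1 v2 v3" "u \<in> board n" "v2 = move u m" "m \<in> knight_moves"
    and "v1 \<in> nbrs G u" "v3 \<in> nbrs G v2"
  shows "{{u, v1}, {v2, v3}} \<in> rails n G"
proof -
  have km: "km u v1 = km v2 v3"
    using assms(1) by (simp add: candidate_def)
  have "km u v2 = m"
    using assms(3) by (simp add: km_def move_def)
  then have "km u v2 \<in> knight_moves" "km v1 v3 \<in> knight_moves"
    using assms(4) parallel_sides[OF km] by simp_all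
  moreover have "v1 \<in> board n" "v3 \<in> board n"
    using assms(5,6) nbrs_subset_board[OF GK] by blast+
  moreover have "v2 \<in> board n"
    using assms(1) by (simp add: candidate_def)
  ultimately have "{u, v2} \<in> knight_graph n" "{v1, v3} \<in> knight_graph n"
    using assms(2) unfolding knight_graph_def by blast+
  moreover have "{u, v2} \<notin> G" "{v1, v3} \<notin> G" "{u, v1} \<in> G" "{v2, v3} \<in> G"
    using assms by (simp_all add: candidate_def nbrs_def)
  ultimately show ?thesis
    using km parallel_sides[OF km] unfolding rails_def by blast
qed

text \<open>A successful test marks u itself; a failing one says exactly that there was no candidate
  or that it met a marked cell.\<close>

lemma probe_inv:
  assumes inv: "scan_inv B Rs s" and u: "u \<in> board n" "reg s ''v'' = code n u"
    and p: "p \<in> set probes"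
  shows "\<exists>Rs'. scan_inv B Rs' (exec (probe p) s) \<and> reg (exec (probe p) s) ''v'' = reg s ''v'' \<and>
    set Rs \<subseteq> set Rs' \<and> covered Rs' u p"
proof -
  obtain a b k l where p_eq: "p = ((a, b), (k, l))" and m: "(a, b) \<in> knight_moves"
    and kl: "k \<in> {0, 1}" "l \<in> {0, 1}"
    using p unfolding set_probes by (cases p) auto
  define v1 where "v1 = nb k u"
  define v2 where "v2 = move u (a, b)"
  define v3 where "v3 = nb l v2"
  have v1: "v1 \<in> board n" "v1 \<in> nbrs G u"
    using nb_board nb_nbrs u(1) kl by (auto simp only: v1_def)
  have v3: "v3 \<in> board n" "v3 \<in> nbrs G v2" if "v2 \<in> board n"
    using nb_board nb_nbrs that kl by (auto simp only: v3_def)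
  define s1 where "s1 = s\<lparr>reg := (reg s)(''w'' := code n v2, ''x'' := code n v1,
    ''y'' := A (8 * code n v2 + l))\<rparr>"
  have n: "reg s ''n'' = int n" and adj: "arr s ''adj'' = A"
    using inv by (auto simp: scan_inv_def)
  have "code n u + (a * int n + b) = code n v2"
    by (simp add: v2_def code_def move_def algebra_simps)
  then have exec: "exec (probe p) s = (if bval (rail_test a b) s1 then exec record_rail s1 else s1)"
    using u n adj aval_scaled[OF m] adj_eq[OF u(1) kl(1)]
    by (simp add: p_eq probe_def s1_def v1_def)
  have inv1: "scan_inv B Rs s1"
    using inv by (simp add: scan_inv_def s1_def stores_rails_def)
  have regs: "reg s1 ''v'' = code n u" "reg s1 ''x'' = code n v1" "reg s1 ''w'' = code n v2"
    using u by (simp_all add: s1_def)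
  have y: "reg s1 ''y'' = code n v3" if "v2 \<in> board n"
    using adj_eq[OF that kl(2)] by (simp add: s1_def v3_def)
  have test: "bval (rail_test a b) s1 \<longleftrightarrow> candidate u v1 v2 v3 \<and> {u, v1, v2, v3} \<inter> marked Rs = {}"
    unfolding v2_def using v1(1) v3(1) u(1) regs y
    by (intro rail_test_iff[OF inv1]) (simp_all only: v2_def)
  have cov: "covered Rs' u p \<longleftrightarrow>
      (candidate u v1 v2 v3 \<longrightarrow> {u, v1, v2, v3} \<inter> marked Rs' \<noteq> {})" for Rs'
    by (simp only: covered_def p_eq v1_def v2_def v3_def prod.case)
  show ?thesis
  proof (cases "bval (rail_test a b) s1")
    case True
    let ?R = "{{u, v1}, {v2, v3}}"
    have c: "candidate u v1 v2 v3" and free: "{u, v1, v2, v3} \<inter> marked Rs = {}"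
      using True test by simp_all
    have v2: "v2 \<in> board n" and km: "km u v1 = km v2 v3"
      using c by (simp_all add: candidate_def)
    have R: "?R \<in> rails n G"
      using candidate_rail[OF c u(1) v2_def m v1(2) v3(2)[OF v2]] .
    note rec = record_rail_inv[OF inv1 regs(1,2,3) y[OF v2] u(1) v1(1) v2 v3(1)[OF v2] R refl km free]
    have "u \<in> marked (Rs @ [?R])"
      by (simp add: marked_def)
    then have "covered (Rs @ [?R]) u p"
      unfolding cov by blast
    then show ?thesis
      using rec True exec regs(1) u(2) by (intro exI[of _ "Rs @ [?R]"]) (simp add: subset_insertI)
  next
    case False
    then have "exec (probe p) s = s1" "covered Rs u p"
      using exec test unfolding cov by (simp_all only: if_False) blast
    then show ?thesis
      using inv1 regs(1) u(2) by (intro exI[of _ Rs]) simp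
  qed
qed

lemma probe_all_inv:
  assumes "scan_inv B Rs s" "u \<in> board n" "reg s ''v'' = code n u" "set ps \<subseteq> set probes"
  shows "\<exists>Rs'. scan_inv B Rs' (exec (probe_all ps) s) \<and>
    reg (exec (probe_all ps) s) ''v'' = reg s ''v'' \<and>
    set Rs \<subseteq> set Rs' \<and> (\<forall>p\<in>set ps. covered Rs' u p)"
  using assms
proof (induction ps arbitrary: Rs s)
  case Nil
  then show ?case by (auto simp: probe_all_def)
next
  case (Cons p ps)
  obtain Rs1 where 1: "scan_inv B Rs1 (exec (probe p) s)"
    "reg (exec (probe p) s) ''v'' = reg s ''v''" "set Rs \<subseteq> set Rs1" "covered Rs1 u p"
    using probe_inv[of B Rs s u p] Cons.prems by auto
  obtain Rs2 where 2: "scan_inv B Rs2 (exec (probe_all ps) (exec (probe p) s))"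
    "reg (exec (probe_all ps) (exec (probe p) s)) ''v'' = reg (exec (probe p) s) ''v''"
    "set Rs1 \<subseteq> set Rs2" "\<forall>p\<in>set ps. covered Rs2 u p"
    using Cons.IH[OF 1(1)] 1(2) Cons.prems by auto
  have "exec (probe_all (p # ps)) s = exec (probe_all ps) (exec (probe p) s)"
    by (simp add: probe_all_def)
  then show ?case
    using 1 2 covered_mono[OF 1(4) 2(3)] by (intro exI[of _ Rs2]) auto
qed

text \<open>Under any of its namings, a rail is found by the probe from v0 along the move to v2
  whose slots lead to v1 and v3.\<close>

lemma covered_maximal:
  assumes disj: "disjoint_rails n G (set Rs)"
    and cov: "\<And>u p. u \<in> board n \<Longrightarrow> p \<in> set probes \<Longrightarrow> covered Rs u p"
  shows "maximal_disjoint_rails n G (set Rs)"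
proof (rule maximal_disjoint_railsI[OF disj])
  fix R
  assume R: "R \<in> rails n G"
  obtain v0 v1 v2 v3 where eq: "R = {{v0, v1}, {v2, v3}}" and km: "km v0 v1 = km v2 v3"
    using rail_cases[OF R] .
  note sw = switch_rail[OF GK R eq km]
  have K: "{v0, v2} \<in> knight_graph n"
    using sw(3) by simp
  have board: "v0 \<in> board n" "v2 \<in> board n" and m: "km v0 v2 \<in> knight_moves"
    using knight_graphD[OF K] by simp_all
  have mv: "move v0 (km v0 v2) = v2"
    by (simp add: move_def km_def)
  have "v1 \<in> nbrs G v0" "v3 \<in> nbrs G v2"
    using sw(1,2) by (simp_all add: nbrs_def)
  then obtain k l where kl: "k \<in> {0, 1}" "l \<in> {0, 1}" "v1 = nb k v0" "v3 = nb l v2"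
    using nbrs_eq[OF board(1)] nbrs_eq[OF board(2)] by blast
  have c: "candidate v0 v1 v2 v3"
    using km sw(3,4) board by (simp add: candidate_def nbrs_def)
  have "(km v0 v2, (k, l)) \<in> set probes"
    using m kl(1,2) unfolding set_probes by (intro SigmaI)
  from cov[OF board(1) this] have "{v0, v1, v2, v3} \<inter> marked Rs \<noteq> {}"
    using c by (simp only: covered_def prod.case mv flip: kl(3,4)) simp
  moreover have "\<Union>R = {v0, v1, v2, v3}"
    unfolding eq by blast
  ultimately show "\<Union>R \<inter> \<Union>(\<Union>(set Rs)) \<noteq> {}"
    by (simp only: marked_def) simp
qed

definition scan_loop_inv :: "(int \<Rightarrow> int) \<Rightarrow> store \<Rightarrow> bool" where
  "scan_loop_inv B s \<longleftrightarrow> 0 \<le> reg s ''v'' \<and> (\<exists>Rs. scan_inv B Rs s \<and>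
    (\<forall>u\<in>board n. code n u < reg s ''v'' \<longrightarrow> (\<forall>p\<in>set probes. covered Rs u p)))"



lemma scan_step_inv:
  assumes inv: "scan_loop_inv B s" and lt: "reg s ''v'' < reg s ''c''"
  shows "scan_loop_inv B (exec scan_step s)"
    "nat (reg (exec scan_step s) ''c'' - reg (exec scan_step s) ''v'') < nat (reg s ''c'' - reg s ''v'')"
proof -
  obtain Rs where Rs: "scan_inv B Rs s"
    and old: "\<And>u p. u \<in> board n \<Longrightarrow> code n u < reg s ''v'' \<Longrightarrow> p \<in> set probes \<Longrightarrow> covered Rs u p"
    using inv unfolding scan_loop_inv_def by blast
  \<comment> \<open>The loop counts codes while the invariant speaks of cells; decoding the counter
    recovers the cell being scanned.\<close>
  define u where "u = decode n (reg s ''v'')"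
  have c: "reg s ''c'' = int n * int n"
    using Rs by (simp add: scan_inv_def)
  have u: "u \<in> board n" "reg s ''v'' = code n u"
    using inv lt c by (simp_all add: u_def code_decode decode_in_board scan_loop_inv_def)
  let ?s = "exec (probe_all probes) s"
  obtain Rs' where Rs': "scan_inv B Rs' ?s" "reg ?s ''v'' = reg s ''v''" "set Rs \<subseteq> set Rs'"
    "\<forall>p\<in>set probes. covered Rs' u p"
    using probe_all_inv[OF Rs u subset_refl] by blast
  have regs: "reg (exec scan_step s) ''v'' = reg s ''v'' + 1"
    "reg (exec scan_step s) ''c'' = reg s ''c''"
    using Rs' c by (simp_all add: scan_step_def scan_inv_def)
  show "nat (reg (exec scan_step s) ''c'' - reg (exec scan_step s) ''v'') < nat (reg s ''c'' - reg s ''v'')"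
    using lt regs by simp
  have "scan_inv B Rs' (exec scan_step s)"
    using Rs'(1) by (simp add: scan_inv_def stores_rails_def scan_step_def)
  moreover have "covered Rs' w p"
    if w: "w \<in> board n" "code n w < reg s ''v'' + 1" "p \<in> set probes" for w p
  proof (cases "w = u")
    case True
    then show ?thesis
      using Rs'(4) w(3) by blast
  next
    case False
    then have "code n w < reg s ''v''"
      using w code_eq_iff[OF w(1) u(1)] u(2) by simp
    then show ?thesis
      using covered_mono[OF old Rs'(3)] w by blast
  qed
  ultimately show "scan_loop_inv B (exec scan_step s)"
    using inv unfolding scan_loop_inv_def regs by (intro conjI exI[of _ Rs']) auto
qed

end

section \<open>The construction phase as a whole\<close>

definition construct_rails :: com where
  "construct_rails =
    Seq (Seq (Assign ''i'' (Lit 0)) (Seq (Assign ''j'' (Lit 0))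
        (Seq (Assign ''c'' (Lit 0)) (Assign ''d'' (Lit 0)))))
    (Seq (While (Less (Reg ''i'') (Reg ''n'')) init_step)
    (Seq (Assign ''v'' (Lit 0))
    (While (Less (Reg ''v'') (Reg ''c'')) scan_step)))"

text \<open>Decoding the slots makes \<open>adj_eq\<close> immediate, because
  \<open>code n (decode n c) = c\<close> holds for every integer c.\<close>

lemma stored_tour_decode:
  assumes reg: "two_regular n G" and G: "stores_graph n G s"
  shows "stored_tour n G (arr s ''adj'') (\<lambda>k v. decode n (arr s ''adj'' (8 * code n v + k)))"
proof
  show "G \<subseteq> knight_graph n"
    using reg by (simp add: two_regular_def)
  fix v k
  assume v: "v \<in> board n"
  obtain x y where xy: "x \<in> board n" "y \<in> board n" "nbrs G v = {x, y}"
    "arr s ''adj'' (8 * code n v) = code n x" "arr s ''adj'' (8 * code n v + 1) = code n y"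
    using G v unfolding stores_graph_iff[OF reg] stores_nbrs_def by blast
  then show "nbrs G v =
      {decode n (arr s ''adj'' (8 * code n v + 0)), decode n (arr s ''adj'' (8 * code n v + 1))}"
    by (simp add: decode_code)
  show "arr s ''adj'' (8 * code n v + k) = code n (decode n (arr s ''adj'' (8 * code n v + k)))"
    by (simp add: code_decode)
qed

text \<open>C adds up costs of fixed program pieces and is chosen before n, G and s; this uniformity
  is what makes the bound quadratic.\<close>

lemma construct_rails_ends:
  obtains C where "\<And>n G s. closed_tour n G \<Longrightarrow> stores_graph n G s \<Longrightarrow>
    ends construct_rails s (Suc (n\<^sup>2) * C) (\<lambda>s'. stores_graph n G s' \<and>
      (\<exists>Rs. stores_rails n Rs s' \<and> distinct Rs \<and> maximal_disjoint_rails n G (set Rs)))"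
proof -
  let ?start = "Seq (Assign ''i'' (Lit 0)) (Seq (Assign ''j'' (Lit 0))
    (Seq (Assign ''c'' (Lit 0)) (Assign ''d'' (Lit 0))))"
  let ?b1 = "Less (Reg ''i'') (Reg ''n'')" and ?b2 = "Less (Reg ''v'') (Reg ''c'')"
  let ?reset = "Assign ''v'' (Lit 0)"
  let ?K1 = "1 + bcost ?b1 + cost_bound init_step" and ?K2 = "1 + bcost ?b2 + cost_bound scan_step"
  have "ends construct_rails s (Suc (n\<^sup>2) * (cost_bound ?start + (?K1 + (cost_bound ?reset + ?K2))))
      (\<lambda>s'. stores_graph n G s' \<and>
        (\<exists>Rs. stores_rails n Rs s' \<and> distinct Rs \<and> maximal_disjoint_rails n G (set Rs)))"
    if tour: "closed_tour n G" and G: "stores_graph n G s" for n G s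
  proof -
    define A where "A = arr s ''adj''"
    define B where "B = arr s ''deg''"
    define nb where "nb k v = decode n (A (8 * code n v + k))" for k v
    interpret stored_tour n G A nb
      using stored_tour_decode[OF closed_tour_two_regular[OF tour] G] by (simp add: A_def nb_def[abs_def])
    let ?I = "\<lambda>s. init_inv n A B s" and ?S = "\<lambda>s. scan_loop_inv B s"
    have sq: "nat (int n * int n) = n\<^sup>2"
      by (simp add: power2_eq_square nat_mult_distrib)
    have 1: "ends ?start s (cost_bound ?start) (\<lambda>s'. ?I s' \<and> reg s' ''c'' = 0)"
    proof (rule ends_loop_free)
      have "\<not> code n v < 0" if "v \<in> board n" for v
        using code_bounds(1)[OF that] by simp
      then show "?I (exec ?start s) \<and> reg (exec ?start s) ''c'' = 0"
        using G closed_tour_pos[OF tour] by (simp add: init_inv_def stores_graph_def A_def B_def)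
    qed simp
    have 2: "ends (While ?b1 init_step) s1 (Suc (n\<^sup>2) * ?K1) (\<lambda>s'. ?I s' \<and> \<not> bval ?b1 s')"
      if "?I s1 \<and> reg s1 ''c'' = 0" for s1
    proof -
      let ?m = "\<lambda>s. nat (int n * int n - reg s ''c'')"
      have "ends (While ?b1 init_step) s1 (Suc (?m s1) * ?K1) (\<lambda>s'. ?I s' \<and> \<not> bval ?b1 s')"
      proof (rule ends_While)
        show "loop_free init_step"
          by (simp add: init_step_def)
        fix s
        assume I: "?I s" and b: "bval ?b1 s"
        have "reg s ''i'' < int n"
          using I b by (simp add: init_inv_def)
        from init_step_inv[OF I this] show "?I (exec init_step s) \<and> ?m (exec init_step s) < ?m s"
          by simp
      qed (use that in simp)
      then show ?thesis
        using that by (simp add: sq)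
    qed
    have 3: "ends ?reset s2 (cost_bound ?reset)
        (\<lambda>s'. ?S s' \<and> reg s' ''v'' = 0 \<and> reg s' ''c'' = int n * int n)"
      if "?I s2 \<and> \<not> bval ?b1 s2" for s2
    proof (rule ends_loop_free)
      have c: "reg s2 ''c'' = int n * int n"
        using that by (auto simp: init_inv_def)
      have "scan_inv B [] (exec ?reset s2)"
        using that c code_bounds(2)
        by (simp add: scan_inv_def init_inv_def marked_def stores_rails_def disjoint_rails_def)
      \<comment> \<open>No code is below 0, so no cell has to be covered yet.\<close>
      then show "?S (exec ?reset s2) \<and> reg (exec ?reset s2) ''v'' = 0 \<and>
          reg (exec ?reset s2) ''c'' = int n * int n"
        using c code_bounds(1) unfolding scan_loop_inv_def
        by (intro conjI exI[of _ "[]"]) (auto simp: not_less[symmetric])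
    qed simp
    have 4: "ends (While ?b2 scan_step) s3 (Suc (n\<^sup>2) * ?K2) (\<lambda>s'. ?S s' \<and> \<not> bval ?b2 s')"
      if "?S s3 \<and> reg s3 ''v'' = 0 \<and> reg s3 ''c'' = int n * int n" for s3
    proof -
      let ?m = "\<lambda>s. nat (reg s ''c'' - reg s ''v'')"
      have "ends (While ?b2 scan_step) s3 (Suc (?m s3) * ?K2) (\<lambda>s'. ?S s' \<and> \<not> bval ?b2 s')"
      proof (rule ends_While)
        show "loop_free scan_step"
          by (simp add: scan_step_def loop_free_probe_all)
        fix s
        assume S: "?S s" and b: "bval ?b2 s"
        from b have "reg s ''v'' < reg s ''c''"
          by simp
        from scan_step_inv[OF S this] show "?S (exec scan_step s) \<and> ?m (exec scan_step s) < ?m s"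
          by simp
      qed (use that in simp)
      then show ?thesis
        using that by (simp add: sq)
    qed
    show ?thesis
      unfolding construct_rails_def
    proof (rule ends_mono[OF ends_Seq[OF 1 ends_Seq[OF 2 ends_Seq[OF 3 4]]]])
      fix s'
      assume s': "?S s' \<and> \<not> bval ?b2 s'"
      then obtain Rs where Rs: "scan_inv B Rs s'"
        and old: "\<And>u p. u \<in> board n \<Longrightarrow> code n u < reg s' ''v'' \<Longrightarrow> p \<in> set probes \<Longrightarrow> covered Rs u p"
        unfolding scan_loop_inv_def by blast
      \<comment> \<open>At the exit the counter has passed the codes of all cells.\<close>
      have "int n * int n \<le> reg s' ''v''"
        using s' Rs by (simp add: scan_inv_def)
      then have "covered Rs u p" if "u \<in> board n" "p \<in> set probes" for u p
        using old that code_bounds(2)[OF that(1)] by simp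
      then have "maximal_disjoint_rails n G (set Rs)"
        using Rs by (intro covered_maximal) (simp_all add: scan_inv_def)
      moreover have "reg s' ''n'' = int n" "arr s' ''adj'' = arr s ''adj''" "arr s' ''deg'' = arr s ''deg''"
        using Rs by (auto simp: scan_inv_def simp flip: A_def B_def)
      then have "stores_graph n G s'"
        using G by (simp add: stores_graph_def adj_list_def)
      ultimately show "stores_graph n G s' \<and>
          (\<exists>Rs. stores_rails n Rs s' \<and> distinct Rs \<and> maximal_disjoint_rails n G (set Rs))"
        using Rs by (auto simp: scan_inv_def)
    next
      show "cost_bound ?start + (Suc (n\<^sup>2) * ?K1 + (cost_bound ?reset + Suc (n\<^sup>2) * ?K2)) \<le>
          Suc (n\<^sup>2) * (cost_bound ?start + (?K1 + (cost_bound ?reset + ?K2)))"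
        unfolding add_mult_distrib2 by (intro add_mono) simp_all
    qed
  qed
  then show ?thesis
    using that by blast
qed

subsection \<open>Switching the stored rails\<close>

text \<open>An entry known to be present and not in slot 0 is in slot 1, so the second branch writes
  without a test.\<close>

definition replace_entry :: "string \<Rightarrow> string \<Rightarrow> string \<Rightarrow> com" where
  "replace_entry x y z = If (Equal (Arr ''adj'' (slot (Reg x) 0)) (Reg y))
    (Store ''adj'' (slot (Reg x) 0) (Reg z)) (Store ''adj'' (slot (Reg x) 1) (Reg z))"

lemma replace_entry_frame:
  "reg (exec (replace_entry x y z) s) = reg s"
  "a \<noteq> ''adj'' \<Longrightarrow> arr (exec (replace_entry x y z) s) a = arr s a"
  by (simp_all add: replace_entry_def)

text \<open>Only one direction of an edge is replaced, hence the general N. That q is not yet listed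
  keeps the two entries distinct.\<close>

lemma replace_entry_nbrs:
  assumes N: "stores_nbrs n N s"
    and regs: "reg s x = code n u" "reg s y = code n p" "reg s z = code n q"
    and u: "u \<in> board n" and p: "p \<in> N u" and q: "q \<in> board n" "q \<notin> N u"
  shows "stores_nbrs n (N(u := insert q (N u - {p}))) (exec (replace_entry x y z) s)"
  unfolding stores_nbrs_def
proof (intro conjI ballI)
  let ?s = "exec (replace_entry x y z) s" and ?N = "N(u := insert q (N u - {p}))"
  show "reg ?s ''n'' = int n"
    using N by (simp add: replace_entry_frame stores_nbrs_def)
  fix v
  assume v: "v \<in> board n"
  obtain a b where ab: "a \<in> board n" "b \<in> board n" "N v = {a, b}" "a \<noteq> b"
    "arr s ''deg'' (code n v) = 2"
    "arr s ''adj'' (8 * code n v) = code n a" "arr s ''adj'' (8 * code n v + 1) = code n b"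
    using N v unfolding stores_nbrs_def by blast
  have deg: "arr ?s ''deg'' (code n v) = 2"
    using ab by (simp add: replace_entry_frame)
  show "\<exists>a\<in>board n. \<exists>b\<in>board n. ?N v = {a, b} \<and> a \<noteq> b \<and> arr ?s ''deg'' (code n v) = 2 \<and>
      arr ?s ''adj'' (8 * code n v) = code n a \<and> arr ?s ''adj'' (8 * code n v + 1) = code n b"
  proof (cases "v = u")
    case False
    then have ne: "code n v \<noteq> code n u"
      using code_eq_iff u v by blast
    \<comment> \<open>Parity separates slot 0 of any cell from slot 1 of any other.\<close>
    have "8 * code n v \<noteq> 8 * code n u + 1" "8 * code n v + 1 \<noteq> 8 * code n u"
      by presburger+
    then have "arr ?s ''adj'' (8 * code n v) = arr s ''adj'' (8 * code n v)"
      "arr ?s ''adj'' (8 * code n v + 1) = arr s ''adj'' (8 * code n v + 1)"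
      using ne regs(1) by (simp_all add: replace_entry_def)
    then show ?thesis
      using ab deg False by (intro bexI[of _ a] bexI[of _ b]) simp_all
  next
    case True
    have eq: "code n a = code n p \<longleftrightarrow> a = p"
      using ab p True by (intro code_eq_iff) auto
    have qab: "q \<noteq> a" "q \<noteq> b"
      using q ab True by auto
    show ?thesis
    proof (cases "a = p")
      case a: True
      have "arr ?s ''adj'' = (arr s ''adj'')(8 * code n u := code n q)"
        using regs ab(6) a True by (simp add: replace_entry_def)
      moreover have "?N v = {q, b}"
        using ab a True by auto
      ultimately show ?thesis
        using ab qab deg q True by (intro bexI[of _ q] bexI[of _ b]) simp_all
    next
      case a: False
      then have b: "b = p"
        using p ab True by auto
      have "arr ?s ''adj'' = (arr s ''adj'')(8 * code n u + 1 := code n q)"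
        using regs ab(6) a eq True by (simp add: replace_entry_def)
      moreover have "?N v = {a, q}"
        using ab b True by auto
      ultimately show ?thesis
        using ab qab deg q True by (intro bexI[of _ a] bexI[of _ q]) simp_all
    qed
  qed
qed

definition switch_step :: com where
  "switch_step =
    Seq (Seq (Assign ''v'' (Arr ''rails'' (quad (Reg ''k'') 0)))
        (Seq (Assign ''x'' (Arr ''rails'' (quad (Reg ''k'') 1)))
        (Seq (Assign ''w'' (Arr ''rails'' (quad (Reg ''k'') 2)))
        (Assign ''y'' (Arr ''rails'' (quad (Reg ''k'') 3))))))
    (Seq (replace_entry ''v'' ''x'' ''w'')
    (Seq (replace_entry ''x'' ''v'' ''y'')
    (Seq (replace_entry ''w'' ''y'' ''v'')
    (Seq (replace_entry ''y'' ''w'' ''x'')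
    (Assign ''k'' (Plus (Reg ''k'') (Lit 1)))))))"

text \<open>Each write treats another of four distinct cells, so later writes still find their
  entries as in G, and the composed updates are those of \<open>nbrs_switch\<close>. Symmetry is
  restored only by the last one.\<close>

lemma switch_step_stores:
  assumes reg: "two_regular n G" and G: "stores_graph n G s" and R: "R \<in> rails n G"
    and eq: "R = {{v0, v1}, {v2, v3}}" and km: "km v0 v1 = km v2 v3"
    and rails: "arr s ''rails'' (4 * reg s ''k'') = code n v0"
      "arr s ''rails'' (4 * reg s ''k'' + 1) = code n v1"
      "arr s ''rails'' (4 * reg s ''k'' + 2) = code n v2"
      "arr s ''rails'' (4 * reg s ''k'' + 3) = code n v3"
  shows "stores_graph n (switch R G) (exec switch_step s)"
    "reg (exec switch_step s) ''k'' = reg s ''k'' + 1"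
    "reg (exec switch_step s) ''d'' = reg s ''d''"
    "arr (exec switch_step s) ''rails'' = arr s ''rails''"
proof -
  have GK: "G \<subseteq> knight_graph n"
    using reg by (simp add: two_regular_def)
  note sw = switch_rail[OF GK R eq km]
  have K: "{v0, v2} \<in> knight_graph n" "{v1, v3} \<in> knight_graph n"
    using sw(3,4) by simp_all
  note board = knight_graphD(1,2)[OF K(1)] knight_graphD(1,2)[OF K(2)]
  have mem: "v1 \<in> nbrs G v0" "v0 \<in> nbrs G v1" "v3 \<in> nbrs G v2" "v2 \<in> nbrs G v3"
    using sw(1,2) by (simp_all add: nbrs_def insert_commute)
  have nmem: "v2 \<notin> nbrs G v0" "v3 \<notin> nbrs G v1" "v0 \<notin> nbrs G v2" "v1 \<notin> nbrs G v3"
    using sw(3,4) by (simp_all add: nbrs_def insert_commute)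
  define s0 where "s0 = s\<lparr>reg := (reg s)(''v'' := code n v0, ''x'' := code n v1,
    ''w'' := code n v2, ''y'' := code n v3)\<rparr>"
  have r0: "reg s0 ''v'' = code n v0" "reg s0 ''x'' = code n v1"
    "reg s0 ''w'' = code n v2" "reg s0 ''y'' = code n v3"
    by (simp_all add: s0_def)
  define s1 where "s1 = exec (replace_entry ''v'' ''x'' ''w'') s0"
  define s2 where "s2 = exec (replace_entry ''x'' ''v'' ''y'') s1"
  define s3 where "s3 = exec (replace_entry ''w'' ''y'' ''v'') s2"
  define s4 where "s4 = exec (replace_entry ''y'' ''w'' ''x'') s3"
  have regs: "reg s1 = reg s0" "reg s2 = reg s0" "reg s3 = reg s0" "reg s4 = reg s0"
    by (simp_all add: s1_def s2_def s3_def s4_def replace_entry_frame)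
  have exec: "exec switch_step s = s4\<lparr>reg := (reg s4)(''k'' := reg s ''k'' + 1)\<rparr>"
  proof -
    have "exec switch_step s = exec (Assign ''k'' (Plus (Reg ''k'') (Lit 1))) s4"
      by (simp add: switch_step_def rails s0_def s1_def s2_def s3_def s4_def)
    then show ?thesis
      by (simp add: regs s0_def)
  qed
  define N0 where "N0 = nbrs G"
  define N1 where "N1 = N0(v0 := insert v2 (N0 v0 - {v1}))"
  define N2 where "N2 = N1(v1 := insert v3 (N1 v1 - {v0}))"
  define N3 where "N3 = N2(v2 := insert v0 (N2 v2 - {v3}))"
  define N4 where "N4 = N3(v3 := insert v1 (N3 v3 - {v2}))"
  have dist: "v0 \<noteq> v1" "v0 \<noteq> v2" "v0 \<noteq> v3" "v1 \<noteq> v2" "v1 \<noteq> v3" "v2 \<noteq> v3"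
    using sw(5) by auto
  have "stores_nbrs n N0 s"
    using G unfolding stores_graph_iff[OF reg] N0_def .
  then have "stores_nbrs n N0 s0"
    by (simp add: stores_nbrs_def s0_def)
  then have "stores_nbrs n N1 s1"
    unfolding N1_def s1_def using r0 board mem nmem
    by (intro replace_entry_nbrs) (simp_all add: N0_def)
  then have "stores_nbrs n N2 s2"
    unfolding N2_def s2_def using r0 board mem nmem dist
    by (intro replace_entry_nbrs) (simp_all add: N0_def N1_def regs)
  then have "stores_nbrs n N3 s3"
    unfolding N3_def s3_def using r0 board mem nmem dist
    by (intro replace_entry_nbrs) (simp_all add: N0_def N1_def N2_def regs)
  then have "stores_nbrs n N4 s4"
    unfolding N4_def s4_def using r0 board mem nmem dist
    by (intro replace_entry_nbrs) (simp_all add: N0_def N1_def N2_def N3_def regs)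
  moreover have "N4 = nbrs (switch R G)"
    unfolding nbrs_switch[OF GK R eq km] using dist
    by (simp add: N0_def N1_def N2_def N3_def N4_def)
  ultimately have "stores_nbrs n (nbrs (switch R G)) (exec switch_step s)"
    unfolding exec by (simp add: stores_nbrs_def)
  then show "stores_graph n (switch R G) (exec switch_step s)"
    using stores_graph_iff[OF two_regular_switch[OF reg R]] by simp
  show "reg (exec switch_step s) ''k'' = reg s ''k'' + 1"
    "reg (exec switch_step s) ''d'' = reg s ''d''"
    unfolding exec by (simp_all add: regs s0_def)
  show "arr (exec switch_step s) ''rails'' = arr s ''rails''"
    unfolding exec by (simp add: s1_def s2_def s3_def s4_def replace_entry_frame) (simp add: s0_def)
qed

definition switch_rails :: com where
  "switch_rails = Seq (Assign ''k'' (Lit 0)) (While (Less (Reg ''k'') (Reg ''d'')) switch_step)"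

lemma switch_rails_ends:
  obtains C where "\<And>n G Rs s. two_regular n G \<Longrightarrow> stores_graph n G s \<Longrightarrow> stores_rails n Rs s \<Longrightarrow>
    distinct Rs \<Longrightarrow> disjoint_rails n G (set Rs) \<Longrightarrow>
    ends switch_rails s (Suc (n\<^sup>2) * C) (\<lambda>s'. stores_graph n (fold switch Rs G) s')"
proof -
  let ?start = "Assign ''k'' (Lit 0)" and ?b = "Less (Reg ''k'') (Reg ''d'')"
  let ?K = "1 + bcost ?b + cost_bound switch_step"
  have "ends switch_rails s (Suc (n\<^sup>2) * (cost_bound ?start + ?K))
      (\<lambda>s'. stores_graph n (fold switch Rs G) s')"
    if reg: "two_regular n G" and G: "stores_graph n G s" and Rs: "stores_rails n Rs s"
      and dist: "distinct Rs" and disj: "disjoint_rails n G (set Rs)" for n G Rs s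
  proof -
    define rest where "rest s' = drop (nat (reg s' ''k'')) Rs" for s' :: store
    \<comment> \<open>G' is the graph after the switches done so far; folding the remaining rails
      over it must still give the intended result.\<close>
    define I where "I s' \<longleftrightarrow> 0 \<le> reg s' ''k'' \<and> reg s' ''d'' = int (length Rs) \<and>
      arr s' ''rails'' = arr s ''rails'' \<and>
      (\<exists>G'. two_regular n G' \<and> disjoint_rails n G' (set (rest s')) \<and> stores_graph n G' s' \<and>
        fold switch (rest s') G' = fold switch Rs G)" for s'
    let ?m = "\<lambda>s'. nat (reg s' ''d'' - reg s' ''k'')"
    have 1: "ends ?start s (cost_bound ?start) (\<lambda>s'. I s' \<and> ?m s' = length Rs)"
    proof (rule ends_loop_free)
      have "stores_graph n G (exec ?start s)"
        using G by (simp add: stores_graph_def adj_list_def)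
      moreover have "rest (exec ?start s) = Rs"
        by (simp add: rest_def)
      ultimately have "I (exec ?start s)"
        unfolding I_def using reg disj Rs
        by (intro conjI exI[of _ G]) (simp_all add: stores_rails_def)
      then show "I (exec ?start s) \<and> ?m (exec ?start s) = length Rs"
        using Rs by (simp add: stores_rails_def)
    qed simp
    have 2: "ends (While ?b switch_step) s1 (Suc (n\<^sup>2) * ?K) (\<lambda>s'. I s' \<and> \<not> bval ?b s')"
      if s1: "I s1 \<and> ?m s1 = length Rs" for s1
    proof -
      have "ends (While ?b switch_step) s1 (Suc (?m s1) * ?K) (\<lambda>s'. I s' \<and> \<not> bval ?b s')"
      proof (rule ends_While)
        show "loop_free switch_step"
          by (simp add: switch_step_def replace_entry_def)
        fix s'
        assume I: "I s'" and b: "bval ?b s'"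
        define k where "k = nat (reg s' ''k'')"
        have k: "reg s' ''k'' = int k" "k < length Rs" and d: "reg s' ''d'' = int (length Rs)"
          and arr': "arr s' ''rails'' = arr s ''rails''"
          using I b by (auto simp: I_def k_def)
        have rest: "rest s' = Rs ! k # drop (Suc k) Rs"
          using k by (simp add: rest_def Cons_nth_drop_Suc)
        obtain G' where G': "two_regular n G'" "disjoint_rails n G' (set (rest s'))"
          "stores_graph n G' s'" "fold switch (rest s') G' = fold switch Rs G"
          using I unfolding I_def by blast
        have R: "Rs ! k \<in> rails n G'"
          using G'(2) by (simp add: rest disjoint_rails_def)
        obtain v0 v1 v2 v3 where v: "Rs ! k = {{v0, v1}, {v2, v3}}" "km v0 v1 = km v2 v3"
          "arr s ''rails'' (4 * int k) = code n v0" "arr s ''rails'' (4 * int k + 1) = code n v1"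
          "arr s ''rails'' (4 * int k + 2) = code n v2" "arr s ''rails'' (4 * int k + 3) = code n v3"
          using Rs k(2) unfolding stores_rails_def by blast
        note step = switch_step_stores[OF G'(1,3) R v(1,2), unfolded arr' k(1), OF v(3-6)]
        have "distinct (rest s')"
          using dist by (simp add: rest_def)
        then have "disjoint_rails n (switch (Rs ! k) G') (set (drop (Suc k) Rs))"
          using G'(1,2) unfolding rest
          by (intro disjoint_rails_switch) (simp_all only: two_regular_def)
        moreover have "rest (exec switch_step s') = drop (Suc k) Rs"
          using step(2) by (simp add: rest_def nat_add_distrib)
        moreover have "fold switch (drop (Suc k) Rs) (switch (Rs ! k) G') = fold switch Rs G"
          using G'(4) by (simp add: rest)
        ultimately have "I (exec switch_step s')"
          unfolding I_def using step d two_regular_switch[OF G'(1) R]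
          by (intro conjI exI[of _ "switch (Rs ! k) G'"]) simp_all
        moreover have "?m (exec switch_step s') < ?m s'"
          using step k d by simp
        ultimately show "I (exec switch_step s') \<and> ?m (exec switch_step s') < ?m s'" ..
      qed (use s1 in simp)
      \<comment> \<open>The loop runs once per rail, and disjoint rails number at most the cells of
        the board.\<close>
      moreover have "Suc (?m s1) * ?K \<le> Suc (n\<^sup>2) * ?K"
        using s1 length_disjoint_rails[OF reg disj dist] by (intro mult_right_mono) simp_all
      ultimately show ?thesis
        by (rule ends_mono)
    qed
    show ?thesis
      unfolding switch_rails_def
    proof (rule ends_mono[OF ends_Seq[OF 1 2]])
      show "cost_bound ?start + Suc (n\<^sup>2) * ?K \<le> Suc (n\<^sup>2) * (cost_bound ?start + ?K)"
        unfolding add_mult_distrib2 by (intro add_mono) simp_all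
      fix s'
      assume s': "I s' \<and> \<not> bval ?b s'"
      then have "rest s' = []"
        by (auto simp: I_def rest_def)
      then show "stores_graph n (fold switch Rs G) s'"
        using s' by (auto simp: I_def)
    qed
  qed
  then show ?thesis
    using that by blast
qed

section \<open>Correctness and the quadratic time bound together\<close>

theorem theorem4:
  shows "(\<forall>n G G'. closed_tour n G \<longrightarrow> shatter n G G' \<longrightarrow> tourney n G') \<and>
    (\<exists>p (T :: nat \<Rightarrow> nat). shatter_program p \<and>
       (\<lambda>n. real (T n)) \<in> O(\<lambda>n. (real n)\<^sup>2) \<and>
       (\<forall>n G s. closed_tour n G \<longrightarrow> stores_graph n G s \<longrightarrow>
          (\<exists>t s' G'. runs p s t s' \<and> t \<le> T n \<and> shatter n G G' \<and> stores_graph n G' s')))"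
proof (intro conjI allI impI)
  fix n G G'
  assume tour: "closed_tour n G" and "shatter n G G'"
  then obtain Rs where "distinct Rs" "maximal_disjoint_rails n G (set Rs)" "G' = fold switch Rs G"
    by (auto simp: shatter_def)
  then show "tourney n G'"
    using closed_tour_two_regular[OF tour]
    by (simp add: two_regular_tourney two_regular_fold_switch maximal_disjoint_rails_def)
next
  obtain C1 where C1: "\<And>n G s. closed_tour n G \<Longrightarrow> stores_graph n G s \<Longrightarrow>
    ends construct_rails s (Suc (n\<^sup>2) * C1) (\<lambda>s'. stores_graph n G s' \<and>
      (\<exists>Rs. stores_rails n Rs s' \<and> distinct Rs \<and> maximal_disjoint_rails n G (set Rs)))"
    using construct_rails_ends by blast
  obtain C2 where C2: "\<And>n G Rs s. two_regular n G \<Longrightarrow> stores_graph n G s \<Longrightarrow> stores_rails n Rs s \<Longrightarrow>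
    distinct Rs \<Longrightarrow> disjoint_rails n G (set Rs) \<Longrightarrow>
    ends switch_rails s (Suc (n\<^sup>2) * C2) (\<lambda>s'. stores_graph n (fold switch Rs G) s')"
    using switch_rails_ends by blast
  have C2': "ends switch_rails s (Suc (n\<^sup>2) * C2) (\<lambda>s'. stores_graph n (fold switch Rs G) s')"
    if "closed_tour n G" "stores_graph n G s" "stores_rails n Rs s" "distinct Rs"
      "maximal_disjoint_rails n G (set Rs)" for n G Rs s
    using that C2[OF closed_tour_two_regular] by (simp add: maximal_disjoint_rails_def)
  let ?p = "Seq construct_rails switch_rails" and ?T = "\<lambda>n. Suc (n\<^sup>2) * (C1 + C2)"
  have "constructs_rails construct_rails"
    unfolding constructs_rails_def using C1 unfolding ends_def by blast
  moreover have "switches_rails switch_rails"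
    unfolding switches_rails_def using C2' unfolding ends_def by blast
  ultimately have "shatter_program ?p"
    unfolding shatter_program_def by blast
  moreover have "(\<lambda>n. real (?T n)) \<in> O(\<lambda>n. (real n)\<^sup>2)"
  proof (rule bigoI)
    \<comment> \<open>The factor 2 absorbs the extra 1 as soon as n is at least 1; at n = 0 the
      right-hand side vanishes.\<close>
    show "\<forall>\<^sub>F n in sequentially. norm (real (?T n)) \<le> real (2 * (C1 + C2)) * norm ((real n)\<^sup>2)"
      using eventually_ge_at_top[of 1]
    proof eventually_elim
      case (elim n)
      then have "Suc (n\<^sup>2) \<le> 2 * n\<^sup>2"
        by simp
      then have "?T n \<le> 2 * n\<^sup>2 * (C1 + C2)"
        by (intro mult_right_mono) simp_all
      then have "real (?T n) \<le> real (2 * n\<^sup>2 * (C1 + C2))"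
        by (rule of_nat_mono)
      also have "\<dots> = real (2 * (C1 + C2)) * norm ((real n)\<^sup>2)"
        by simp
      finally show ?case
        by simp
    qed
  qed
  moreover have "\<exists>t s' G'. runs ?p s t s' \<and> t \<le> ?T n \<and> shatter n G G' \<and> stores_graph n G' s'"
    if tour: "closed_tour n G" and G: "stores_graph n G s" for n G s
  proof -
    have "ends ?p s (Suc (n\<^sup>2) * C1 + Suc (n\<^sup>2) * C2)
        (\<lambda>s'. \<exists>G'. shatter n G G' \<and> stores_graph n G' s')"
    proof (rule ends_Seq[OF C1[OF tour G]])
      fix s'
      assume "stores_graph n G s' \<and>
        (\<exists>Rs. stores_rails n Rs s' \<and> distinct Rs \<and> maximal_disjoint_rails n G (set Rs))"
      then obtain Rs where "stores_graph n G s'" and Rs: "stores_rails n Rs s'" "distinct Rs"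
        "maximal_disjoint_rails n G (set Rs)"
        by blast
      then show "ends switch_rails s' (Suc (n\<^sup>2) * C2) (\<lambda>s'. \<exists>G'. shatter n G G' \<and> stores_graph n G' s')"
        by (intro ends_mono[OF C2'[OF tour, of s' Rs]]) (auto simp: shatter_def)
    qed
    then show ?thesis
      unfolding ends_def by (simp add: add_mult_distrib2)
  qed
  ultimately show "\<exists>p (T :: nat \<Rightarrow> nat). shatter_program p \<and>
      (\<lambda>n. real (T n)) \<in> O(\<lambda>n. (real n)\<^sup>2) \<and>
      (\<forall>n G s. closed_tour n G \<longrightarrow> stores_graph n G s \<longrightarrow>
        (\<exists>t s' G'. runs p s t s' \<and> t \<le> T n \<and> shatter n G G' \<and> stores_graph n G' s'))"
    by (intro exI[of _ ?p] exI[of _ ?T]) blast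
qed

end
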